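(* There exist numbers $W_{d,\varepsilon}$ (for $d \ge 1$ an integer and $\varepsilon > 0$) with $W_{d,\varepsilon} \sim \log(d/\varepsilon)$ as $d/\varepsilon \to \infty$, such that the following holds. For any $\varepsilon > 0$ and integer $d \ge 1$, there exists an online random sampling algorithm using a sequence $\mathbf{B}$ of i.i.d. fair coin tosses such that, for every distribution sequence $\mathbf{p} = (p_i)_{i\ge 1} \in (\Delta\mathcal{X}_d)^{\mathbb{N}}$, the entropy cost of generating an output sequence $\mathbf{X} = (X_i \sim p_i)_{i \ge 1}$ satisfies \[ \mathbb{E}\left[t_n(\mathbf{B}, \mathbf{p}) \mid X_1=x_1, \dots, X_n=x_n\right] < \sum_{i=1}^{n}\log\left( \frac{1}{p_i(x_i)} \right) + \varepsilon n + W_{d,\varepsilon} \qquad (n \ge 1), \] for every positive-probability event $\{X_1=x_1, \dots, X_n=x_n\}$. Moreover, the algorithm uses auxiliary space of at most $2W_{d,\varepsilon}$ bits carried over between rounds and $O(W_{d,\varepsilon})$ temporary space per round.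
   Context: All logarithms are base 2. $\mathcal{X} = \{\alpha_1,\dots,\alpha_l\}$ is a finite alphabet and $\Delta\mathcal{X}$ is the set of rational probability distributions $p:\mathcal{X}\to[0,1]\cap\mathbb{Q}$. $\Delta\mathcal{X}_d$ is the set of $p \in \Delta\mathcal{X}$ whose least common denominator (the least positive integer $k$ with $k\,p(\alpha)\in\mathbb{N}$ for all $\alpha$) is at most $d$. An online random sampling algorithm keeps an auxiliary state (from a countable set, with a fixed initial state) carried between rounds; in round $i = 1,2,\dots$ it is given the target distribution $p_i$, reads some number $\tau_i \ge 0$ of fresh coin tosses from an i.i.d. uniform bit stream $\mathbf{B}$ (never rereading tosses used in earlier rounds), halts with probability one, and outputs a symbol $x_i \in \mathcal{X}$ and an updated state. Correctness: for every fixed sequence $\mathbf{p}$, the outputs satisfy $\mathbb{P}(X_1=x_1,\dots,X_n=x_n)=\prod_{i=1}^n p_i(x_i)$ for all $n$ and $x_1,\dots,x_n$. The entropy cost $t_n(\mathbf{B},\mathbf{p}) = \tau_1 + \dots + \tau_n$ is the total number of coin tosses consumed in rounds $1$ through $n$. *)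

theory Defs
  imports
    "HOL-Probability.Probability"
    "HOL-Library.Landau_Symbols"
    "HOL-Library.While_Combinator"
    "HOL-Library.Log_Nat"
begin

definition rat_dists :: "'a set \<Rightarrow> ('a \<Rightarrow> rat) set" where
  "rat_dists X = {p \<in> X \<rightarrow>\<^sub>E {0..1}. sum p X = 1}"

definition least_common_denom :: "'a set \<Rightarrow> ('a \<Rightarrow> rat) \<Rightarrow> nat" where
  "least_common_denom X p = (LEAST k. 0 < k \<and> (\<forall>a\<in>X. of_nat k * p a \<in> \<nat>))"

definition rat_dists_upto :: "'a set \<Rightarrow> nat \<Rightarrow> ('a \<Rightarrow> rat) set" where
  "rat_dists_upto X d = {p \<in> rat_dists X. least_common_denom X p \<le> d}"

text \<open>
  A distribution is handed to the algorithm on a read-only input tape. It is represented by its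
  integer weights over the least common denominator; cell number j of the tape holds the
  binary digits of order j of all these weights, as the set of symbols whose digit is one.
\<close>

definition weight :: "'a set \<Rightarrow> ('a \<Rightarrow> rat) \<Rightarrow> 'a \<Rightarrow> nat" where
  "weight X p a = nat \<lfloor>of_nat (least_common_denom X p) * p a\<rfloor>"

definition input_tape :: "'a set \<Rightarrow> ('a \<Rightarrow> rat) \<Rightarrow> 'a set list" where
  "input_tape X p =
     map (\<lambda>j. {a \<in> X. bit (weight X p a) j}) [0..<floorlog 2 (least_common_denom X p)]"

text \<open>
  An online sampling algorithm works on a read-write memory holding a bit string. A round starts
  with the memory holding exactly the carried state and with the input head on cell 0. Each action
  depends only on the memory and the scanned cell (\<open>None\<close> at the right end of the tape): toss a
  fresh coin and store the result, move the input head, or end the round with an output symbol and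
  a new state to be carried over. As usual for machines with a read-only input and a one-way random
  tape, space means the length of the read-write memory; head positions are not counted.
\<close>

datatype 'a action =
    Toss "bool \<Rightarrow> bool list"
  | Move_Left "bool list"
  | Move_Right "bool list"
  | is_Halt: Halt (out_symbol: 'a) (out_state: "bool list")

record 'a sampler =
  init_state :: "bool list"
  act :: "bool list \<Rightarrow> 'a set option \<Rightarrow> 'a action"

text \<open>A configuration consists of the memory, the position of the input head, and the number of
  coin tosses consumed since the start of the first round.\<close>

type_synonym config = "bool list \<times> nat \<times> nat"

fun next_action :: "'a sampler \<Rightarrow> 'a set list \<Rightarrow> config \<Rightarrow> 'a action" where
  "next_action S w (m, h, t) = act S m (if h < length w then Some (w ! h) else None)"

fun step :: "'a sampler \<Rightarrow> 'a set list \<Rightarrow> (nat \<Rightarrow> bool) \<Rightarrow> config \<Rightarrow> config" where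
  "step S w B (m, h, t) =
     (case next_action S w (m, h, t) of
        Toss f \<Rightarrow> (f (B t), h, Suc t)
      | Move_Left m' \<Rightarrow> (m', h - 1, t)
      | Move_Right m' \<Rightarrow> (m', min (Suc h) (length w), t)
      | Halt x s \<Rightarrow> (m, h, t))"

text \<open>One round from carried state \<open>s\<close> when \<open>t\<close> tosses are already consumed; the result is \<open>None\<close>
  iff the round does not halt.\<close>

definition run_round ::
  "'a sampler \<Rightarrow> 'a set list \<Rightarrow> (nat \<Rightarrow> bool) \<Rightarrow> bool list \<Rightarrow> nat \<Rightarrow> ('a \<times> bool list \<times> nat) option"
where
  "run_round S w B s t =
     map_option
       (\<lambda>c. (out_symbol (next_action S w c), out_state (next_action S w c), snd (snd c)))
       (while_option (\<lambda>c. \<not> is_Halt (next_action S w c)) (step S w B) (s, 0, t))"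

text \<open>The first \<open>n\<close> rounds: outputs, carried state, and total number of tosses. The target of
  the first round is \<open>p 0\<close>.\<close>

primrec run ::
  "'a sampler \<Rightarrow> 'a set \<Rightarrow> (nat \<Rightarrow> 'a \<Rightarrow> rat) \<Rightarrow> (nat \<Rightarrow> bool) \<Rightarrow> nat \<Rightarrow> ('a list \<times> bool list \<times> nat) option"
where
  "run S X p B 0 = Some ([], init_state S, 0)"
| "run S X p B (Suc n) =
     Option.bind (run S X p B n) (\<lambda>(xs, s, t).
       map_option (\<lambda>(x, s', t'). (xs @ [x], s', t'))
         (run_round S (input_tape X (p n)) B s t))"

definition coins :: "(nat \<Rightarrow> bool) measure" where
  "coins = (\<Pi>\<^sub>M i\<in>UNIV. measure_pmf (bernoulli_pmf (1/2)))"

definition output_event ::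
  "'a sampler \<Rightarrow> 'a set \<Rightarrow> (nat \<Rightarrow> 'a \<Rightarrow> rat) \<Rightarrow> 'a list \<Rightarrow> (nat \<Rightarrow> bool) set"
where
  "output_event S X p xs =
     {B \<in> space coins. \<exists>s t. run S X p B (length xs) = Some (xs, s, t)}"

definition entropy_cost ::
  "'a sampler \<Rightarrow> 'a set \<Rightarrow> (nat \<Rightarrow> 'a \<Rightarrow> rat) \<Rightarrow> nat \<Rightarrow> (nat \<Rightarrow> bool) \<Rightarrow> ennreal"
where
  "entropy_cost S X p n B =
     (case run S X p B n of None \<Rightarrow> \<infinity> | Some (xs, s, t) \<Rightarrow> of_nat t)"

definition online_sampler :: "'a set \<Rightarrow> 'a sampler \<Rightarrow> bool" where
  "online_sampler X S \<longleftrightarrow>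
     (\<forall>p. (\<forall>i. p i \<in> rat_dists X) \<longrightarrow>
        (AE B in coins. \<forall>n. run S X p B n \<noteq> None) \<and>
        (\<forall>xs \<in> lists X.
           measure coins (output_event S X p xs) = (\<Prod>i<length xs. of_rat (p i (xs ! i)))))"

text \<open>Both space bounds are worst-case over the coin tosses.\<close>

definition carried_space_le ::
  "'a sampler \<Rightarrow> 'a set \<Rightarrow> (nat \<Rightarrow> 'a \<Rightarrow> rat) \<Rightarrow> real \<Rightarrow> bool"
where
  "carried_space_le S X p b \<longleftrightarrow>
     (\<forall>B n xs s t. run S X p B n = Some (xs, s, t) \<longrightarrow> real (length s) \<le> b)"

definition temp_space_le ::
  "'a sampler \<Rightarrow> 'a set \<Rightarrow> (nat \<Rightarrow> 'a \<Rightarrow> rat) \<Rightarrow> real \<Rightarrow> bool"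
where
  "temp_space_le S X p b \<longleftrightarrow>
     (\<forall>B n xs s t j. run S X p B n = Some (xs, s, t) \<longrightarrow>
        real (length (fst ((step S (input_tape X (p n)) B ^^ j) (s, 0, t)))) \<le> b)"

end

theory Submission
  imports Defs "HOL-Real_Asymp.Real_Asymp"
begin

text \<open>
  The main sampler carries a pair \<open>(Z, M)\<close> such that \<open>Z\<close> is uniform on \<open>{..<M}\<close> given all outputs so
  far. A round tosses coins, each of them doubling \<open>M\<close>, until \<open>M\<close> has about \<open>v\<close> bits. If \<open>k\<close> is the
  denominator of the target and \<open>Z < (M div k) * k\<close>, then \<open>Z mod k\<close> selects the output \<open>a\<close>, and
  \<open>Z div k\<close> together with the position of \<open>Z mod k\<close> among the \<open>k * p a\<close> residues that select \<open>a\<close> is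
  uniform on a set of \<open>(M div k) * k * p a\<close> elements and is carried over; otherwise the state is
  discarded and the round starts again. The tosses made minus \<open>log 2 M\<close> grow in a round by
  \<open>log 2 (1 / p a)\<close> plus a loss of order \<open>v * d / 2 ^ v\<close>, so that \<open>v\<close> may be taken as
  \<open>log 2 (d / \<epsilon>)\<close> up to a lower order term.

  If \<open>\<epsilon>\<close> is at least of order \<open>log 2 d\<close>, then \<open>log 2 (d / \<epsilon>)\<close> can be far below \<open>log 2 d\<close>, so that
  even the target distribution need not fit into the memory. There each round may cost a multiple of
  \<open>log 2 d\<close>, so no state has to be carried over, and for large \<open>\<epsilon>\<close> the target is
  sampled with a number of memory bits that depends on the alphabet only.
\<close>

section \<open>Expected payoffs of sampler runs\<close>

interpretation coin_space: sequence_space "measure_pmf (bernoulli_pmf (1/2))"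
  by unfold_locales

interpretation coins: prob_space coins
  unfolding coins_def by unfold_locales

lemma space_coins [simp]: "space coins = UNIV"
  by (simp add: coins_def space_PiM)

lemma measurable_coin [measurable]: "(\<lambda>B. B t) \<in> measurable coins (count_space UNIV)"
proof -
  have "(\<lambda>B. B t) \<in> measurable coins (measure_pmf (bernoulli_pmf (1/2)))"
    unfolding coins_def by (rule measurable_component_singleton) simp
  thus ?thesis by simp
qed

abbreviation halting :: "'a sampler \<Rightarrow> 'a set list \<Rightarrow> (nat \<Rightarrow> bool) \<Rightarrow> config \<Rightarrow> config option" where
  "halting S w B c \<equiv> while_option (\<lambda>c. \<not> is_Halt (next_action S w c)) (step S w B) c"

abbreviation scan :: "'a set list \<Rightarrow> nat \<Rightarrow> 'a set option" where
  "scan w h \<equiv> (if h < length w then Some (w ! h) else None)"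

lemma measurable_step: "(\<lambda>B. step S w B c) \<in> measurable coins (count_space UNIV)"
proof (cases c)
  case (fields m h t)
  show ?thesis
  proof (cases "next_action S w c")
    case (Toss f)
    have "(\<lambda>B. (f (B t), h, Suc t)) \<in> measurable coins (count_space UNIV)"
      by measurable
    with Toss fields show ?thesis by simp
  qed (use fields in simp_all)
qed

lemma measurable_steps: "(\<lambda>B. (step S w B ^^ k) c) \<in> measurable coins (count_space UNIV)"
proof (induction k)
  case (Suc k)
  show ?case
    using measurable_compose_countable[OF measurable_step Suc] by simp
qed simp

lemma while_option_eq_Some_iff:
  "while_option b f c = Some c' \<longleftrightarrow>
     (\<exists>k. (f ^^ k) c = c' \<and> \<not> b c' \<and> (\<forall>j<k. b ((f ^^ j) c)))"
proof
  assume "while_option b f c = Some c'"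
  then show "\<exists>k. (f ^^ k) c = c' \<and> \<not> b c' \<and> (\<forall>j<k. b ((f ^^ j) c))"
    unfolding while_option_def
    by (auto split: if_splits intro!: exI[of _ "LEAST k. \<not> b ((f ^^ k) c)"]
        dest: not_less_Least LeastI[of "\<lambda>k. \<not> b ((f ^^ k) c)"])
next
  assume "\<exists>k. (f ^^ k) c = c' \<and> \<not> b c' \<and> (\<forall>j<k. b ((f ^^ j) c))"
  then obtain k where k: "(f ^^ k) c = c'" "\<not> b c'" "\<forall>j<k. b ((f ^^ j) c)" by blast
  then have "(LEAST k. \<not> b ((f ^^ k) c)) = k"
    by (intro Least_equality) (auto simp: not_less[symmetric])
  with k show "while_option b f c = Some c'"
    unfolding while_option_def by auto
qed

lemma pred_halting [measurable]: "Measurable.pred coins (\<lambda>B. halting S w B c = Some c')"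
proof -
  have [measurable]: "Measurable.pred coins (\<lambda>B. Q ((step S w B ^^ k) c))" for Q k
    by (rule measurable_compose[OF measurable_steps]) simp
  show ?thesis
    unfolding while_option_eq_Some_iff by measurable
qed

primrec follow :: "'a sampler \<Rightarrow> 'a set \<Rightarrow> 'a list \<Rightarrow> (nat \<Rightarrow> 'a \<Rightarrow> rat) \<Rightarrow> (nat \<Rightarrow> bool)
    \<Rightarrow> bool list \<times> nat \<Rightarrow> (bool list \<times> nat) option"
where
  "follow S X [] p B st = Some st"
| "follow S X (x # xs) p B st =
     (case run_round S (input_tape X (p 0)) B (fst st) (snd st) of
        None \<Rightarrow> None
      | Some (y, st') \<Rightarrow> if y = x then follow S X xs (\<lambda>i. p (Suc i)) B st' else None)"

definition follow_from :: "'a sampler \<Rightarrow> 'a set \<Rightarrow> 'a \<Rightarrow> 'a list \<Rightarrow> (nat \<Rightarrow> 'a \<Rightarrow> rat) \<Rightarrow> (nat \<Rightarrow> bool)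
    \<Rightarrow> config \<Rightarrow> (bool list \<times> nat) option"
where
  "follow_from S X x xs p B c =
     (case halting S (input_tape X (p 0)) B c of
        None \<Rightarrow> None
      | Some c' \<Rightarrow>
          if out_symbol (next_action S (input_tape X (p 0)) c') = x
          then follow S X xs (\<lambda>i. p (Suc i)) B
                 (out_state (next_action S (input_tape X (p 0)) c'), snd (snd c'))
          else None)"

lemma follow_Cons: "follow S X (x # xs) p B (s, t) = follow_from S X x xs p B (s, 0, t)"
  by (auto simp: follow_from_def run_round_def split: option.splits)

lemma follow_snoc:
  "follow S X (xs @ [x]) p B st = Some (s', t') \<longleftrightarrow>
     (\<exists>s t. follow S X xs p B st = Some (s, t) \<and>
        run_round S (input_tape X (p (length xs))) B s t = Some (x, s', t'))"
proof (induction xs arbitrary: p st)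
  case (Cons y xs)
  then show ?case by (auto split: option.splits prod.splits)
qed (auto split: option.splits prod.splits)

lemma run_iff_follow:
  "run S X p B (length xs) = Some (xs, s, t) \<longleftrightarrow> follow S X xs p B (init_state S, 0) = Some (s, t)"
proof (induction xs arbitrary: s t rule: rev_induct)
  case (snoc x xs)
  have "run S X p B (length (xs @ [x])) = Some (xs @ [x], s, t) \<longleftrightarrow>
    (\<exists>s' t'. run S X p B (length xs) = Some (xs, s', t') \<and>
       run_round S (input_tape X (p (length xs))) B s' t' = Some (x, s, t))"
    by (auto simp: bind_eq_Some_conv)
  then show ?case unfolding snoc follow_snoc .
qed auto

lemma follow_from_eq_Some_iff:
  "follow_from S X x xs p B c = Some r \<longleftrightarrow>
     (\<exists>c'. halting S (input_tape X (p 0)) B c = Some c' \<and>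
       out_symbol (next_action S (input_tape X (p 0)) c') = x \<and>
       follow S X xs (\<lambda>i. p (Suc i)) B
         (out_state (next_action S (input_tape X (p 0)) c'), snd (snd c')) = Some r)"
  unfolding follow_from_def
  by (cases "halting S (input_tape X (p 0)) B c") (simp_all del: next_action.simps split_paired_Ex)

lemma pred_follow [measurable]: "Measurable.pred coins (\<lambda>B. follow S X xs p B st = Some r)"
proof (induction xs arbitrary: p st)
  case (Cons x xs)
  obtain s t where st: "st = (s, t)" by (cases st)
  show ?case
    unfolding st follow_Cons follow_from_eq_Some_iff using Cons by measurable
qed simp

lemma measurable_option_countable:
  fixes f :: "'b \<Rightarrow> 'c::countable option"
  assumes [measurable]: "\<And>r. Measurable.pred M (\<lambda>x. f x = Some r)"
  shows "f \<in> measurable M (count_space UNIV)"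
proof -
  have "Measurable.pred M (\<lambda>x. f x = r)" for r
  proof (cases r)
    case None
    have "(\<lambda>x. f x = None) = (\<lambda>x. \<not> (\<exists>r. f x = Some r))" by auto
    also have "Measurable.pred M \<dots>" by measurable
    finally show ?thesis using None by simp
  qed simp
  then have "f -` {r} \<inter> space M \<in> sets M" for r
    unfolding pred_def by (simp add: vimage_def Int_def conj_commute)
  then show ?thesis
    by (simp add: measurable_count_space_eq2_countable)
qed

lemma measurable_follow:
  "(\<lambda>B. follow S X xs p B st) \<in> measurable coins (count_space UNIV)"
  by (rule measurable_option_countable) simp

lemma measurable_follow_from:
  "(\<lambda>B. follow_from S X x xs p B c) \<in> measurable coins (count_space UNIV)"
  by (rule measurable_option_countable) (unfold follow_from_eq_Some_iff, measurable)

definition shift_time :: "nat \<Rightarrow> bool list \<times> nat \<Rightarrow> bool list \<times> nat" where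
  "shift_time k = (\<lambda>(s, t). (s, t + k))"

lemma halting_shift:
  "halting S w B (m, h, t + k) =
     map_option (\<lambda>(m, h, t). (m, h, t + k)) (halting S w (\<lambda>i. B (i + k)) (m, h, t))"
proof -
  let ?f = "\<lambda>(m, h, t). (m, h, t + k) :: config"
  have na: "next_action S w (?f c) = next_action S w c" for c
    by (cases c) simp
  have "map_option ?f (halting S w (\<lambda>i. B (i + k)) (m, h, t)) = halting S w B (?f (m, h, t))"
  proof (rule while_option_commute)
    fix c show "?f (step S w (\<lambda>i. B (i + k)) c) = step S w B (?f c)"
      by (cases c) (auto split: action.splits)
  qed (simp add: na)
  then show ?thesis by simp
qed

lemma follow_shift:
  "follow S X xs p B (s, t + k) =
     map_option (shift_time k) (follow S X xs p (\<lambda>i. B (i + k)) (s, t))"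
proof (induction xs arbitrary: p s t)
  case (Cons x xs)
  show ?case
    unfolding follow_Cons follow_from_def halting_shift
    by (auto split: option.splits simp: Cons)
qed (simp add: shift_time_def)

lemma follow_from_shift:
  "follow_from S X x xs p B (m, h, t + k) =
     map_option (shift_time k) (follow_from S X x xs p (\<lambda>i. B (i + k)) (m, h, t))"
  unfolding follow_from_def halting_shift
  by (auto split: option.splits simp: follow_shift)

definition bounded_reward :: "(nat \<Rightarrow> real) \<Rightarrow> bool" where
  "bounded_reward g \<longleftrightarrow> (\<exists>K. \<forall>t. 0 \<le> g t \<and> g t \<le> K)"

definition payoff :: "(nat \<Rightarrow> real) \<Rightarrow> (bool list \<times> nat) option \<Rightarrow> real" where
  "payoff g r = (case r of None \<Rightarrow> 0 | Some (s, t) \<Rightarrow> g t)"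

lemma payoff_simps [simp]: "payoff g None = 0" "payoff g (Some (s, t)) = g t"
  by (simp_all add: payoff_def)

lemma payoff_shift: "payoff g (map_option (shift_time k) r) = payoff (\<lambda>t. g (t + k)) r"
  by (cases r) (auto simp: shift_time_def)

definition value0 :: "'a sampler \<Rightarrow> 'a set \<Rightarrow> (nat \<Rightarrow> real) \<Rightarrow> (nat \<Rightarrow> 'a \<Rightarrow> rat) \<Rightarrow> 'a list
    \<Rightarrow> bool list \<Rightarrow> real"
where
  "value0 S X g p xs s = (\<integral>B. payoff g (follow S X xs p B (s, 0)) \<partial>coins)"

definition val :: "'a sampler \<Rightarrow> 'a set \<Rightarrow> (nat \<Rightarrow> real) \<Rightarrow> (nat \<Rightarrow> 'a \<Rightarrow> rat) \<Rightarrow> 'a \<Rightarrow> 'a list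
    \<Rightarrow> bool list \<Rightarrow> nat \<Rightarrow> real"
where
  "val S X g p x xs m h = (\<integral>B. payoff g (follow_from S X x xs p B (m, h, 0)) \<partial>coins)"

lemma value0_Nil [simp]: "value0 S X g p [] s = g 0"
  using coins.prob_space by (simp add: value0_def)

lemma value0_Cons: "value0 S X g p (x # xs) s = val S X g p x xs s 0"
  by (simp only: value0_def val_def follow_Cons)

lemma val_Halt:
  assumes "act S m (scan (input_tape X (p 0)) h)
    = Halt y s"
  shows "val S X g p x xs m h = (if y = x then value0 S X g (\<lambda>i. p (Suc i)) xs s else 0)"
proof -
  let ?w = "input_tape X (p 0)"
  have na: "next_action S ?w (m, h, 0) = Halt y s" using assms by simp
  have "halting S ?w B (m, h, 0) = Some (m, h, 0)" for B
    by (subst while_option_unfold) (simp only: na action.disc simp_thms if_False)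
  then have "follow_from S X x xs p B (m, h, 0) =
      (if y = x then follow S X xs (\<lambda>i. p (Suc i)) B (s, 0) else None)" for B
    unfolding follow_from_def using na by simp
  then show ?thesis by (simp add: val_def value0_def)
qed

lemma halting_step:
  "\<not> is_Halt (next_action S w c) \<Longrightarrow> halting S w B c = halting S w B (step S w B c)"
  by (subst while_option_unfold) simp

lemma follow_from_step:
  "\<not> is_Halt (next_action S (input_tape X (p 0)) c) \<Longrightarrow>
     follow_from S X x xs p B c = follow_from S X x xs p B (step S (input_tape X (p 0)) B c)"
  unfolding follow_from_def by (subst halting_step) simp_all

lemma val_Move_Left:
  assumes "act S m (scan (input_tape X (p 0)) h)
    = Move_Left m'"
  shows "val S X g p x xs m h = val S X g p x xs m' (h - 1)"
  using follow_from_step[of S X p "(m, h, 0)" x xs] assms by (simp add: val_def)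

lemma val_Move_Right:
  assumes "act S m (scan (input_tape X (p 0)) h)
    = Move_Right m'"
  shows "val S X g p x xs m h = val S X g p x xs m' (min (Suc h) (length (input_tape X (p 0))))"
  using follow_from_step[of S X p "(m, h, 0)" x xs] assms by (simp add: val_def)

lemma measurable_payoff: "f \<in> measurable coins (count_space UNIV) \<Longrightarrow>
  (\<lambda>B. payoff g (f B)) \<in> borel_measurable coins"
  by (rule measurable_compose[of f]) auto

lemma abs_payoff_le: "(\<And>t. 0 \<le> g t \<and> g t \<le> K) \<Longrightarrow> \<bar>payoff g r\<bar> \<le> K"
  by (cases r) (auto, meson order_trans)

lemma integrable_payoff:
  assumes "f \<in> measurable coins (count_space UNIV)" "bounded_reward g"
  shows "integrable coins (\<lambda>B. payoff g (f B))"
proof -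
  obtain K where "\<And>t. 0 \<le> g t \<and> g t \<le> K" using assms(2) by (auto simp: bounded_reward_def)
  then show ?thesis
    using assms(1)
    by (intro coins.integrable_const_bound[of _ K] AE_I2) (auto intro: abs_payoff_le measurable_payoff)
qed

lemma integral_first_toss:
  fixes f :: "(nat \<Rightarrow> bool) \<Rightarrow> real"
  assumes f [measurable]: "f \<in> borel_measurable coins" and "\<And>B. \<bar>f B\<bar> \<le> K"
  shows "(\<integral>B. f B \<partial>coins) =
    ((\<integral>B. f (case_nat True B) \<partial>coins) + (\<integral>B. f (case_nat False B) \<partial>coins)) / 2"
proof -
  let ?M = "measure_pmf (bernoulli_pmf (1/2))"
  interpret P: pair_prob_space ?M coins ..
  have iter: "distr (?M \<Otimes>\<^sub>M coins) coins (\<lambda>(s, \<omega>). case_nat s \<omega>) = coins"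
    unfolding coins_def by (rule coin_space.PiM_iter)
  have m [measurable]: "(\<lambda>(s, \<omega>). case_nat s \<omega>) \<in> measurable (?M \<Otimes>\<^sub>M coins) coins"
    unfolding coins_def by measurable
  have int: "integrable (?M \<Otimes>\<^sub>M coins) (\<lambda>(s, \<omega>). f (case_nat s \<omega>))"
    using assms(2) by (intro P.integrable_const_bound[of _ K]) auto
  have "(\<integral>B. f B \<partial>coins) = (\<integral>z. f (case z of (s, \<omega>) \<Rightarrow> case_nat s \<omega>) \<partial>(?M \<Otimes>\<^sub>M coins))"
    by (subst iter[symmetric], rule integral_distr) measurable
  also have "\<dots> = (\<integral>z. (case z of (s, \<omega>) \<Rightarrow> f (case_nat s \<omega>)) \<partial>(?M \<Otimes>\<^sub>M coins))"
    by (rule Bochner_Integration.integral_cong) auto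
  also have "\<dots> = (\<integral>s. (\<integral>\<omega>. f (case_nat s \<omega>) \<partial>coins) \<partial>?M)"
    using P.integral_fst'[OF int] by simp
  finally show ?thesis by simp
qed

lemma val_Toss:
  assumes a: "act S m (scan (input_tape X (p 0)) h)
    = Toss f" and g: "bounded_reward g"
  shows "val S X g p x xs m h =
    (val S X (\<lambda>t. g (Suc t)) p x xs (f True) h + val S X (\<lambda>t. g (Suc t)) p x xs (f False) h) / 2"
proof -
  obtain K where K: "\<And>t. 0 \<le> g t \<and> g t \<le> K" using g by (auto simp: bounded_reward_def)
  have "follow_from S X x xs p (case_nat b B) (m, h, 0) =
      map_option (shift_time 1) (follow_from S X x xs p B (f b, h, 0))" for b B
    using follow_from_step[of S X p "(m, h, 0)" x xs "case_nat b B"] a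
      follow_from_shift[of S X x xs p "case_nat b B" "f b" h 0 1] by simp
  then have "(\<integral>B. payoff g (follow_from S X x xs p (case_nat b B) (m, h, 0)) \<partial>coins) =
      val S X (\<lambda>t. g (Suc t)) p x xs (f b) h" for b
    by (simp add: payoff_shift val_def)
  moreover have "\<bar>payoff g (follow_from S X x xs p B (m, h, 0))\<bar> \<le> K" for B
    by (rule abs_payoff_le) (rule K)
  ultimately show ?thesis
    unfolding val_def[of S X g]
    by (subst integral_first_toss[of _ K]) (auto intro: measurable_payoff measurable_follow_from)
qed

lemma bounded_reward_Suc: "bounded_reward g \<Longrightarrow> bounded_reward (\<lambda>t. g (Suc t))"
  by (auto simp: bounded_reward_def)

lemma bounded_reward_const [simp]: "bounded_reward (\<lambda>_. 1)"
  by (auto simp: bounded_reward_def)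

definition capped :: "nat \<Rightarrow> nat \<Rightarrow> real" where "capped K t = real (min t K)"

lemma bounded_reward_capped [simp]: "bounded_reward (capped K)"
  by (auto simp: bounded_reward_def capped_def intro: exI[of _ "real K"])

lemma val_nonneg: "bounded_reward g \<Longrightarrow> 0 \<le> val S X g p x xs m h"
  unfolding val_def
  by (rule integral_nonneg_AE) (auto simp: bounded_reward_def payoff_def split: option.splits)

lemma val_capped_Suc:
  "val S X (\<lambda>t. capped K (Suc t)) p x xs m h
     \<le> val S X (\<lambda>_. 1) p x xs m h + val S X (capped K) p x xs m h"
proof -
  have "val S X (\<lambda>t. capped K (Suc t)) p x xs m h \<le>
    (\<integral>B. payoff (\<lambda>_. 1) (follow_from S X x xs p B (m, h, 0)) +
         payoff (capped K) (follow_from S X x xs p B (m, h, 0)) \<partial>coins)"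
    unfolding val_def
    by (intro integral_mono integrable_payoff Bochner_Integration.integrable_add
        measurable_follow_from bounded_reward_Suc[OF bounded_reward_capped]
        bounded_reward_capped bounded_reward_const)
      (auto simp: payoff_def capped_def split: option.splits)
  also have "\<dots> = val S X (\<lambda>_. 1) p x xs m h + val S X (capped K) p x xs m h"
    unfolding val_def
    by (intro Bochner_Integration.integral_add integrable_payoff
        measurable_follow_from bounded_reward_capped bounded_reward_const)
  finally show ?thesis .
qed

lemma val_Toss_prob:
  assumes "act S m (scan (input_tape X (p 0)) h)
    = Toss f"
  shows "val S X (\<lambda>_. 1) p x xs m h =
    (val S X (\<lambda>_. 1) p x xs (f True) h + val S X (\<lambda>_. 1) p x xs (f False) h) / 2"
  using val_Toss[where p = p, OF assms bounded_reward_const] .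

lemma val_Toss_capped:
  assumes "act S m (scan (input_tape X (p 0)) h)
    = Toss f"
  shows "val S X (capped K) p x xs m h \<le> val S X (\<lambda>_. 1) p x xs m h +
    (val S X (capped K) p x xs (f True) h + val S X (capped K) p x xs (f False) h) / 2"
  using val_Toss[where p = p, OF assms bounded_reward_capped[of K], of x xs]
    val_Toss_prob[where p = p, OF assms, of x xs]
    val_capped_Suc[of S X K p x xs "f True" h] val_capped_Suc[of S X K p x xs "f False" h]
  by argo

lemma output_event_follow:
  "output_event S X p xs = {B. \<exists>r. follow S X xs p B (init_state S, 0) = Some r}"
  by (auto simp: output_event_def run_iff_follow)

lemma sets_output_event [measurable]: "output_event S X p xs \<in> sets coins"
proof -
  have "Measurable.pred coins (\<lambda>B. \<exists>r. follow S X xs p B (init_state S, 0) = Some r)"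
    by measurable
  then show ?thesis by (simp add: output_event_follow pred_def)
qed

lemma measure_output_event:
  "measure coins (output_event S X p xs) = value0 S X (\<lambda>_. 1) p xs (init_state S)"
proof -
  have "value0 S X (\<lambda>_. 1) p xs (init_state S) = (\<integral>B. indicator (output_event S X p xs) B \<partial>coins)"
    unfolding value0_def
    by (rule Bochner_Integration.integral_cong)
      (auto simp: output_event_follow payoff_def indicator_def split: option.splits)
  then show ?thesis by simp
qed

lemma nn_integral_entropy_cost_le:
  assumes pos: "measure coins (output_event S X p xs) > 0"
    and bound: "\<And>K. value0 S X (capped K) p xs (init_state S)
      \<le> measure coins (output_event S X p xs) * C"
  shows "(\<integral>\<^sup>+B. entropy_cost S X p (length xs) B
            \<partial>uniform_measure coins (output_event S X p xs)) \<le> ennreal C"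
proof -
  let ?E = "output_event S X p xs" and ?P = "measure coins (output_event S X p xs)"
  let ?f = "\<lambda>B. follow S X xs p B (init_state S, 0)"
  let ?u = "\<lambda>K B. ennreal (payoff (capped K) (?f B))"
  have C: "0 \<le> C"
  proof -
    have "0 \<le> value0 S X (capped 0) p xs (init_state S)"
      unfolding value0_def by (rule integral_nonneg_AE) (auto simp: payoff_def capped_def split: option.splits)
    with bound[of 0] have "0 \<le> ?P * C" by linarith
    with pos show ?thesis by (simp add: zero_le_mult_iff)
  qed
  have meas [measurable]: "?u K \<in> borel_measurable coins" for K
    using measurable_payoff[OF measurable_follow] by measurable
  have sup: "entropy_cost S X p (length xs) B = (SUP K. ?u K B)" if "B \<in> ?E" for B
  proof -
    from that obtain s t where st: "?f B = Some (s, t)" by (auto simp: output_event_follow)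
    then have "entropy_cost S X p (length xs) B = of_nat t"
      unfolding entropy_cost_def using iffD2[OF run_iff_follow, of S X xs p B] by simp
    moreover have "(SUP K. ?u K B) = of_nat t"
    proof (rule antisym)
      show "(SUP K. ?u K B) \<le> of_nat t"
        by (rule SUP_least) (auto simp: st capped_def ennreal_of_nat_eq_real_of_nat intro!: ennreal_leI)
      show "of_nat t \<le> (SUP K. ?u K B)"
        by (rule SUP_upper2[of t]) (auto simp: st capped_def ennreal_of_nat_eq_real_of_nat)
    qed
    ultimately show ?thesis by simp
  qed
  have "(\<integral>\<^sup>+B. entropy_cost S X p (length xs) B \<partial>uniform_measure coins ?E) =
      (\<integral>\<^sup>+B. (SUP K. ?u K B) \<partial>uniform_measure coins ?E)"
    by (intro nn_integral_cong_AE AE_uniform_measureI) (auto simp: sup)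
  also have "\<dots> = (\<integral>\<^sup>+B. (SUP K. ?u K B) * indicator ?E B \<partial>coins) / emeasure coins ?E"
    by (intro nn_integral_uniform_measure) measurable
  also have "\<dots> \<le> ennreal (?P * C) / emeasure coins ?E"
  proof (intro divide_right_mono_ennreal)
    have "(\<integral>\<^sup>+B. (SUP K. ?u K B) * indicator ?E B \<partial>coins) \<le> (\<integral>\<^sup>+B. (SUP K. ?u K B) \<partial>coins)"
      by (intro nn_integral_mono) (auto simp: indicator_def)
    also have "\<dots> = (SUP K. \<integral>\<^sup>+B. ?u K B \<partial>coins)"
    proof (rule nn_integral_monotone_convergence_SUP[OF _ meas])
      show "incseq ?u"
        by (auto simp: incseq_def le_fun_def payoff_def capped_def split: option.splits
            intro!: ennreal_leI)
    qed
    also have "\<dots> \<le> ennreal (?P * C)"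
    proof (rule SUP_least)
      fix K
      have "(\<integral>\<^sup>+B. ?u K B \<partial>coins) = ennreal (value0 S X (capped K) p xs (init_state S))"
        unfolding value0_def
        by (intro nn_integral_eq_integral integrable_payoff measurable_follow)
          (auto simp: payoff_def capped_def split: option.splits)
      then show "(\<integral>\<^sup>+B. ?u K B \<partial>coins) \<le> ennreal (?P * C)"
        using bound[of K] by (simp add: ennreal_leI)
    qed
    finally show "(\<integral>\<^sup>+B. (SUP K. ?u K B) * indicator ?E B \<partial>coins) \<le> ennreal (?P * C)" .
  qed
  also have "\<dots> = ennreal C"
    using pos C by (simp add: coins.emeasure_eq_measure divide_ennreal)
  finally show ?thesis .
qed

lemma sum_prod_lists:
  fixes q :: "nat \<Rightarrow> 'a \<Rightarrow> real"
  assumes "finite X" "\<And>i. (\<Sum>a\<in>X. q i a) = 1"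
  shows "(\<Sum>xs | set xs \<subseteq> X \<and> length xs = n. \<Prod>i<length xs. q i (xs ! i)) = 1"
  using assms(2)
proof (induction n arbitrary: q)
  case 0
  have "{xs. set xs \<subseteq> X \<and> length xs = 0} = {[]}" by auto
  then show ?case by simp
next
  case (Suc n)
  let ?L = "{xs. set xs \<subseteq> X \<and> length xs = n}"
  have img: "{xs. set xs \<subseteq> X \<and> length xs = Suc n} = (\<lambda>(x, xs). x # xs) ` (X \<times> ?L)"
    by (auto simp: image_iff length_Suc_conv)
  have "(\<Sum>xs | set xs \<subseteq> X \<and> length xs = Suc n. \<Prod>i<length xs. q i (xs ! i)) =
      (\<Sum>(x, xs)\<in>X \<times> ?L. \<Prod>i<length (x # xs). q i ((x # xs) ! i))"
    unfolding img by (subst sum.reindex) (auto simp: inj_on_def case_prod_beta)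
  also have "\<dots> = (\<Sum>(x, xs)\<in>X \<times> ?L. q 0 x * (\<Prod>i<length xs. q (Suc i) (xs ! i)))"
    by (rule sum.cong) (auto simp: prod.lessThan_Suc_shift simp del: prod.lessThan_Suc)
  also have "\<dots> = (\<Sum>x\<in>X. q 0 x) * (\<Sum>xs\<in>?L. \<Prod>i<length xs. q (Suc i) (xs ! i))"
    by (subst sum_product) (simp only: sum.cartesian_product)
  finally show ?case using Suc.IH[of "\<lambda>i. q (Suc i)"] Suc.prems by simp
qed

text \<open>The output probabilities of the words of length \<open>n\<close> add up to one, so that
  non-termination has probability zero.\<close>

lemma online_samplerI:
  fixes X :: "'a set"
  assumes X: "finite X"
    and prob: "\<And>p xs. (\<And>i. p i \<in> rat_dists X) \<Longrightarrow> set xs \<subseteq> X \<Longrightarrow>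
      value0 S X (\<lambda>_. 1) p xs (init_state S) = (\<Prod>i<length xs. of_rat (p i (xs ! i)))"
  shows "online_sampler X S"
  unfolding online_sampler_def
proof (intro allI impI conjI ballI)
  fix p :: "nat \<Rightarrow> 'a \<Rightarrow> rat" and xs assume p: "\<forall>i. p i \<in> rat_dists X" and "xs \<in> lists X"
  then show "measure coins (output_event S X p xs) = (\<Prod>i<length xs. of_rat (p i (xs ! i)))"
    unfolding measure_output_event by (intro prob) auto
next
  fix p :: "nat \<Rightarrow> 'a \<Rightarrow> rat" assume p: "\<forall>i. p i \<in> rat_dists X"
  have "AE B in coins. run S X p B n \<noteq> None" for n
  proof -
    let ?L = "{xs. set xs \<subseteq> X \<and> length xs = n}"
    have fin: "finite ?L" using finite_lists_length_eq[OF X, of n] by simp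
    have "measure coins (\<Union>xs\<in>?L. output_event S X p xs) = (\<Sum>xs\<in>?L. measure coins (output_event S X p xs))"
    proof (rule coins.finite_measure_finite_Union[OF fin])
      show "disjoint_family_on (output_event S X p) ?L"
        by (auto simp: disjoint_family_on_def output_event_def)
    qed auto
    also have "\<dots> = (\<Sum>xs\<in>?L. \<Prod>i<length xs. of_rat (p i (xs ! i)))"
      unfolding measure_output_event using p by (intro sum.cong prob) auto
    also have "\<dots> = 1"
    proof (rule sum_prod_lists[OF X])
      fix i
      have "(\<Sum>a\<in>X. p i a) = 1" using p by (auto simp: rat_dists_def)
      then have "of_rat (\<Sum>a\<in>X. p i a) = (1::real)" by simp
      then show "(\<Sum>a\<in>X. of_rat (p i a)) = (1::real)" by (simp add: of_rat_sum)
    qed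
    finally have "AE B in coins. B \<in> (\<Union>xs\<in>?L. output_event S X p xs)"
      using fin by (subst (asm) coins.prob_eq_1) auto
    then show ?thesis
      by eventually_elim (auto simp: output_event_def)
  qed
  then show "AE B in coins. \<forall>n. run S X p B n \<noteq> None"
    by (simp add: AE_all_countable)
qed

lemma run_invariant:
  assumes init: "init_state S \<in> I"
    and start: "\<And>n s. s \<in> I \<Longrightarrow> (s, 0) \<in> R n"
    and step: "\<And>n m h t B m' h' t'. (m, h) \<in> R n \<Longrightarrow>
      step S (input_tape X (p n)) B (m, h, t) = (m', h', t') \<Longrightarrow> (m', h') \<in> R n"
    and halt: "\<And>n m h x s. (m, h) \<in> R n \<Longrightarrow>
      act S m (scan (input_tape X (p n)) h) = Halt x s \<Longrightarrow> s \<in> I"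
    and run: "run S X p B n = Some (xs, s, t)"
  shows "s \<in> I"
    and "\<exists>h. (fst ((step S (input_tape X (p n)) B ^^ j) (s, 0, t)), h) \<in> R n"
proof -
  have steps: "(fst c, fst (snd c)) \<in> R n"
    if "(m, h) \<in> R n" "c = (step S (input_tape X (p n)) B ^^ j) (m, h, t)" for n m h t c j B
    using that(2)
  proof (induction j arbitrary: c)
    case (Suc j)
    obtain m' h' t' where c': "(step S (input_tape X (p n)) B ^^ j) (m, h, t) = (m', h', t')"
      by (cases "(step S (input_tape X (p n)) B ^^ j) (m, h, t)") auto
    with Suc.IH have "(m', h') \<in> R n" by fastforce
    moreover have "step S (input_tape X (p n)) B (m', h', t') = (fst c, fst (snd c), snd (snd c))"
      using Suc.prems c' by simp
    ultimately show ?case by (rule step)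
  qed (use that in simp)
  have inI: "run S X p B n = Some (xs, s, t) \<Longrightarrow> s \<in> I" for n xs s t
  proof (induction n arbitrary: xs s t)
    case 0
    then show ?case using init by simp
  next
    case (Suc n)
    then obtain xs' s' t' x where r: "run S X p B n = Some (xs', s', t')"
      "run_round S (input_tape X (p n)) B s' t' = Some (x, s, t)"
      by (auto simp: bind_eq_Some_conv)
    then obtain c where c: "halting S (input_tape X (p n)) B (s', 0, t') = Some c"
      "s = out_state (next_action S (input_tape X (p n)) c)"
      by (auto simp: run_round_def simp del: next_action.simps)
    obtain k where k: "c = (step S (input_tape X (p n)) B ^^ k) (s', 0, t')"
      "is_Halt (next_action S (input_tape X (p n)) c)"
      using while_option_stop2[OF c(1)] by blast
    have "(fst c, fst (snd c)) \<in> R n"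
      using steps[OF start k(1)] Suc.IH[OF r(1)] by blast
    moreover have "act S (fst c) (scan (input_tape X (p n)) (fst (snd c))) =
        Halt (out_symbol (next_action S (input_tape X (p n)) c)) s"
      using k(2) c(2) by (cases c) (auto simp: is_Halt_def)
    ultimately show ?case by (rule halt)
  qed
  from inI[OF run] show "s \<in> I" .
  then show "\<exists>h. (fst ((step S (input_tape X (p n)) B ^^ j) (s, 0, t)), h) \<in> R n"
    using steps[OF start refl] by blast
qed

section \<open>Weights of a tape\<close>

definition wt :: "'a set list \<Rightarrow> 'a \<Rightarrow> nat" where
  "wt w a = (\<Sum>j<length w. if a \<in> w ! j then 2 ^ j else 0)"

definition tape_total :: "'a set \<Rightarrow> 'a set list \<Rightarrow> nat" where
  "tape_total X w = (\<Sum>a\<in>X. wt w a)"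

lemma least_common_denom:
  assumes "finite X" "p \<in> rat_dists X"
  shows "0 < least_common_denom X p" "a \<in> X \<Longrightarrow> of_nat (least_common_denom X p) * p a \<in> \<nat>"
proof -
  let ?den = "\<lambda>a. nat (snd (quotient_of (p a)))"
  let ?k = "\<Prod>a\<in>X. ?den a"
  have pos: "0 < ?den a" for a using quotient_of_denom_pos'[of "p a"] by simp
  have "of_nat ?k * p a \<in> \<nat>" if a: "a \<in> X" for a
  proof -
    obtain n d where nd: "quotient_of (p a) = (n, d)" by (cases "quotient_of (p a)")
    have d: "d > 0" using quotient_of_denom_pos[OF nd] .
    have pa: "p a = of_int n / of_int d" using quotient_of_div[OF nd] .
    have "0 \<le> p a" using assms a by (auto simp: rat_dists_def)
    then have n: "0 \<le> n" using pa d by (simp add: zero_le_divide_iff)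
    have "of_nat ?k * p a = of_nat (\<Prod>a\<in>X - {a}. ?den a) * (of_nat (?den a) * p a)"
      using prod.remove[OF assms(1) a, of ?den] by (simp add: mult.commute mult.left_commute)
    also have "of_nat (?den a) * p a = of_nat (nat n)"
      using nd d n by (simp add: pa of_nat_nat)
    finally show ?thesis by (metis of_nat_in_Nats of_nat_mult)
  qed
  then have "0 < ?k \<and> (\<forall>a\<in>X. of_nat ?k * p a \<in> \<nat>)" using pos by (auto intro: prod_pos)
  then have "0 < least_common_denom X p \<and> (\<forall>a\<in>X. of_nat (least_common_denom X p) * p a \<in> \<nat>)"
    unfolding least_common_denom_def by (rule LeastI)
  then show "0 < least_common_denom X p" "a \<in> X \<Longrightarrow> of_nat (least_common_denom X p) * p a \<in> \<nat>"
    by blast+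
qed

lemma input_tape_props:
  assumes X: "finite X" and p: "p \<in> rat_dists X"
  shows wt_input_tape: "a \<in> X \<Longrightarrow> of_rat (p a) = real (wt (input_tape X p) a) / real (tape_total X (input_tape X p))"
    and total_input_tape: "tape_total X (input_tape X p) = least_common_denom X p"
    and total_input_tape_pos: "0 < tape_total X (input_tape X p)"
    and length_input_tape_pos: "0 < length (input_tape X p)"
    and total_input_tape_ge: "2 ^ (length (input_tape X p) - 1) \<le> tape_total X (input_tape X p)"
    and set_input_tape: "set (input_tape X p) \<subseteq> Pow X"
proof -
  let ?k = "least_common_denom X p"
  note k = least_common_denom[OF X p]
  have weight: "of_nat (weight X p a) = of_nat ?k * p a" if "a \<in> X" for a
  proof -
    from k(2)[OF that] obtain n where "of_nat ?k * p a = of_nat n" by (auto elim: Nats_cases)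
    then show ?thesis by (simp add: weight_def)
  qed
  have p1: "(\<Sum>a\<in>X. p a) = 1" using p by (simp add: rat_dists_def)
  have "of_nat (\<Sum>a\<in>X. weight X p a) = (of_nat ?k :: rat)"
    using p1 by (simp add: weight sum_distrib_left[symmetric])
  then have sumw: "(\<Sum>a\<in>X. weight X p a) = ?k" by (simp only: of_nat_eq_iff)
  have b: "2 ^ (floorlog 2 ?k - 1) \<le> ?k" "?k < 2 ^ floorlog 2 ?k"
    using floorlog_bounds[of ?k 2] k(1) by auto
  have wt: "wt (input_tape X p) a = weight X p a" if "a \<in> X" for a
  proof -
    have "weight X p a \<le> ?k"
      using member_le_sum[OF that, of "weight X p"] X sumw by simp
    then have "take_bit (floorlog 2 ?k) (weight X p a) = weight X p a"
      using b by (simp add: take_bit_nat_eq_self)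
    moreover have "wt (input_tape X p) a = (\<Sum>j<floorlog 2 ?k. push_bit j (of_bool (bit (weight X p a) j)))"
      unfolding wt_def by (rule sum.cong) (auto simp: input_tape_def that push_bit_eq_mult)
    ultimately show ?thesis by (simp add: take_bit_sum lessThan_atLeast0)
  qed
  show tot: "tape_total X (input_tape X p) = ?k"
    unfolding tape_total_def using sumw wt by simp
  then show "0 < tape_total X (input_tape X p)" using k(1) by simp
  show "0 < length (input_tape X p)"
    using k(1) by (auto simp: input_tape_def floorlog_def)
  show "2 ^ (length (input_tape X p) - 1) \<le> tape_total X (input_tape X p)"
    using b(1) unfolding tot by (simp add: input_tape_def)
  show "set (input_tape X p) \<subseteq> Pow X" by (auto simp: input_tape_def)
  assume a: "a \<in> X"
  have "p a = of_nat (weight X p a) / of_nat ?k" using weight[OF a] k(1) by simp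
  then have "of_rat (p a) = (of_rat (of_nat (weight X p a) / of_nat ?k) :: real)" by simp
  then show "of_rat (p a) = real (wt (input_tape X p) a) / real (tape_total X (input_tape X p))"
    by (simp add: of_rat_divide tot wt[OF a])
qed

lemma length_input_tape_le:
  assumes "finite X" "p \<in> rat_dists_upto X d"
  shows "real (length (input_tape X p)) \<le> log 2 (real d) + 1"
proof -
  have p: "p \<in> rat_dists X" and le: "least_common_denom X p \<le> d"
    using assms by (auto simp: rat_dists_upto_def)
  have "2 ^ (length (input_tape X p) - 1) \<le> d"
    using total_input_tape_ge[OF assms(1) p] total_input_tape[OF assms(1) p] le by linarith
  then have "real (length (input_tape X p) - 1) \<le> log 2 (real d)"
    by (intro le_log_of_power) (auto simp flip: of_nat_power)
  then show ?thesis using length_input_tape_pos[OF assms(1) p] by simp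
qed

section \<open>Encoding of memory contents\<close>

definition nat_bits :: "nat \<Rightarrow> bool list" where
  "nat_bits n = map (bit n) [0..<floorlog 2 n]"

lemma nat_bits_inj: "nat_bits m = nat_bits n \<Longrightarrow> m = n"
proof -
  have "horner_sum of_bool 2 (nat_bits n) = n" for n :: nat
  proof -
    have "n < 2 ^ floorlog 2 n" by (rule floorlog_leD) simp_all
    then show ?thesis
      by (simp add: nat_bits_def horner_sum_bit_eq_take_bit take_bit_nat_eq_self)
  qed
  then show "nat_bits m = nat_bits n \<Longrightarrow> m = n" by metis
qed

lemma length_nat_bits_le: "n < 2 ^ j \<Longrightarrow> length (nat_bits n) \<le> j"
  by (simp add: nat_bits_def floorlog_leI)

definition cell_code :: "'a set \<Rightarrow> 'a set \<Rightarrow> nat" where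
  "cell_code X c = set_encode (to_nat_on X ` c)"

primrec tape_code :: "'a set \<Rightarrow> 'a set list \<Rightarrow> nat" where
  "tape_code X [] = 0"
| "tape_code X (c # cs) = tape_code X cs * 2 ^ Suc (card X) + Suc (cell_code X c)"

lemma cell_code_less:
  assumes "finite X" "c \<subseteq> X"
  shows "Suc (cell_code X c) < 2 ^ Suc (card X)"
proof -
  have "to_nat_on X ` c \<subseteq> {..<card X}"
    using to_nat_on_finite[OF assms(1)] assms(2) by (auto simp: bij_betw_def)
  then have "cell_code X c \<le> set_encode {..<card X}"
    unfolding cell_code_def set_encode_def by (intro sum_mono2) auto
  also have "\<dots> = 2 ^ card X - 1"
    by (simp add: set_encode_def mask_eq_sum_exp_nat lessThan_def)
  also have "\<dots> < 2 ^ card X" by simp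
  finally have "cell_code X c < 2 ^ card X" .
  then show ?thesis by simp
qed

lemma cell_code_inj:
  assumes "finite X" "c \<subseteq> X" "c' \<subseteq> X" "cell_code X c = cell_code X c'"
  shows "c = c'"
proof -
  have "finite c" "finite c'" using assms finite_subset by auto
  then have "to_nat_on X ` c = to_nat_on X ` c'"
    using assms(4) by (simp add: cell_code_def set_encode_eq)
  moreover have "inj_on (to_nat_on X) X"
    using to_nat_on_finite[OF assms(1)] by (simp add: bij_betw_def)
  ultimately show ?thesis
    using assms(2,3) by (simp add: inj_on_image_eq_iff)
qed

lemma tape_code_inj:
  assumes "finite X" "set cs \<subseteq> Pow X" "set cs' \<subseteq> Pow X" "tape_code X cs = tape_code X cs'"
  shows "cs = cs'"
  using assms(2-)
proof (induction cs arbitrary: cs')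
  case Nil
  then show ?case by (cases cs') simp_all
next
  case (Cons c cs)
  then obtain c' ds where cs': "cs' = c' # ds" by (cases cs') auto
  let ?b = "2 ^ Suc (card X) :: nat"
  have l: "Suc (cell_code X c) < ?b" "Suc (cell_code X c') < ?b"
    using Cons.prems cs' cell_code_less[OF assms(1)] by auto
  have eq: "Suc (cell_code X c) + tape_code X cs * ?b = Suc (cell_code X c') + tape_code X ds * ?b"
    using Cons.prems cs' by (simp only: tape_code.simps add.commute)
  then have "(Suc (cell_code X c) + tape_code X cs * ?b) mod ?b = (Suc (cell_code X c') + tape_code X ds * ?b) mod ?b"
    "(Suc (cell_code X c) + tape_code X cs * ?b) div ?b = (Suc (cell_code X c') + tape_code X ds * ?b) div ?b"
    by simp_all
  then have "Suc (cell_code X c) = Suc (cell_code X c')" "tape_code X cs = tape_code X ds"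
    using l by (simp_all only: mod_mult_self1 div_mult_self1 mod_less div_less)
  then have "c = c'" "cs = ds"
    using Cons.prems(1,2) cs' cell_code_inj[OF assms(1), of c c'] Cons.IH[of ds] by simp_all
  then show ?case by (simp add: cs')
qed

lemma tape_code_less:
  assumes "finite X" "set cs \<subseteq> Pow X"
  shows "tape_code X cs < 2 ^ (Suc (card X) * length cs)"
  using assms(2)
proof (induction cs)
  case (Cons c cs)
  let ?b = "2 ^ Suc (card X) :: nat"
  have "tape_code X (c # cs) < (tape_code X cs + 1) * ?b"
    using cell_code_less[OF assms(1), of c] Cons.prems by simp
  also have "\<dots> \<le> 2 ^ (Suc (card X) * length cs) * ?b"
    using Cons by (intro mult_right_mono) auto
  finally show ?case by (simp add: power_add mult.commute)
qed simp

text \<open>Contents without cells are tagged separately because \<open>prod_encode\<close> squares the numbers: a carried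
  state has to take only twice the bits of \<open>M\<close>.\<close>

definition enc :: "'a set \<Rightarrow> nat \<times> nat \<times> 'a set list \<Rightarrow> bool list" where
  "enc X = (\<lambda>(Z, M, cs). nat_bits (sum_encode
     (if cs = [] then Inl (prod_encode (Z, M))
      else Inr (prod_encode (prod_encode (Z, M), tape_code X cs)))))"

lemma inj_on_enc:
  assumes "finite X"
  shows "inj_on (enc X) {(Z, M, cs). set cs \<subseteq> Pow X}"
proof (rule inj_onI)
  fix x y assume x: "x \<in> {(Z :: nat, M :: nat, cs). set cs \<subseteq> Pow X}"
    and y: "y \<in> {(Z :: nat, M :: nat, cs). set cs \<subseteq> Pow X}" and "enc X x = enc X y"
  then show "x = y"
    by (auto simp: enc_def sum_encode_eq split: if_splits dest!: nat_bits_inj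
        intro: tape_code_inj[OF assms])
qed

lemma prod_encode_less:
  assumes "a < 2 ^ i" "b < 2 ^ i"
  shows "prod_encode (a, b) < 2 ^ (2 * i + 1)"
proof -
  have "prod_encode (a, b) < triangle (Suc (a + b))" by (simp add: prod_encode_def)
  also have "\<dots> \<le> 2 ^ (2 * i + 1)"
  proof -
    have "2 * triangle (Suc (a + b)) = Suc (a + b) * Suc (Suc (a + b))"
      by (simp add: triangle_def)
    also have "\<dots> \<le> (2 * 2 ^ i) * (2 * 2 ^ i)"
      using assms by (intro mult_mono) auto
    also have "\<dots> = 2 * 2 ^ (2 * i + 1)" by (simp add: power_add power_mult power2_eq_square mult.commute)
    finally show ?thesis by simp
  qed
  finally show ?thesis .
qed

lemma length_enc_Nil:
  assumes "Z < M" "M < 2 ^ Suc v"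
  shows "length (enc X (Z, M, [])) \<le> 2 * v + 4"
proof -
  have "prod_encode (Z, M) < 2 ^ (2 * Suc v + 1)" using assms by (intro prod_encode_less) auto
  then have "2 * prod_encode (Z, M) < 2 ^ Suc (2 * Suc v + 1)" by (simp only: power_Suc)
  then have "2 * prod_encode (Z, M) < 2 ^ (2 * v + 4)" by (simp add: eval_nat_numeral)
  then show ?thesis by (simp add: enc_def sum_encode_def length_nat_bits_le)
qed

lemma length_enc:
  assumes "finite X" "Z < M" "M < 2 ^ Suc v" "set cs \<subseteq> Pow X"
  shows "length (enc X (Z, M, cs)) \<le> 4 * v + 8 + 2 * (Suc (card X) * length cs)"
proof (cases "cs = []")
  case True
  then show ?thesis using length_enc_Nil[OF assms(2,3), of X] by simp
next
  case False
  let ?i = "2 * v + 3 + Suc (card X) * length cs"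
  have "prod_encode (Z, M) < 2 ^ (2 * Suc v + 1)" using assms by (intro prod_encode_less) auto
  also have "\<dots> \<le> 2 ^ ?i" by (intro power_increasing) auto
  finally have 1: "prod_encode (Z, M) < 2 ^ ?i" .
  have "tape_code X cs < 2 ^ (Suc (card X) * length cs)"
    by (rule tape_code_less[OF assms(1,4)])
  also have "\<dots> \<le> 2 ^ ?i" by (intro power_increasing) auto
  finally have "tape_code X cs < 2 ^ ?i" .
  from prod_encode_less[OF 1 this]
  have "Suc (2 * prod_encode (prod_encode (Z, M), tape_code X cs)) < 2 * 2 ^ (2 * ?i + 1)"
    by linarith
  also have "\<dots> = 2 ^ (2 * ?i + 2)" by (simp only: power_Suc[symmetric]) simp
  finally have "Suc (2 * prod_encode (prod_encode (Z, M), tape_code X cs)) < 2 ^ (2 * ?i + 2)" .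
  then have "length (enc X (Z, M, cs)) \<le> 2 * ?i + 2"
    using False unfolding enc_def by (simp add: sum_encode_def length_nat_bits_le)
  then show ?thesis by simp
qed

lemma length_enc_init: "length (enc X (0, 1, [])) \<le> 2"
  by (simp add: enc_def sum_encode_def prod_encode_def length_nat_bits_le)

section \<open>The sampler with recycled randomness\<close>

definition slot :: "'a set \<Rightarrow> 'a set list \<Rightarrow> nat \<Rightarrow> 'a \<times> nat" where
  "slot X w = (SOME f. bij_betw f {..<tape_total X w} (SIGMA a:X. {..<wt w a}))"

lemma bij_betw_slot:
  assumes "finite X"
  shows "bij_betw (slot X w) {..<tape_total X w} (SIGMA a:X. {..<wt w a})"
proof -
  have "card (SIGMA a:X. {..<wt w a}) = tape_total X w"
    using assms by (simp add: tape_total_def)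
  then have "\<exists>f. bij_betw f {..<tape_total X w} (SIGMA a:X. {..<wt w a})"
    using ex_bij_betw_nat_finite[of "SIGMA a:X. {..<wt w a}"] assms by (auto simp: lessThan_atLeast0)
  then show ?thesis unfolding slot_def by (rule someI_ex)
qed

locale recycler =
  fixes X :: "'a set" and v :: nat and keep :: bool
  assumes finX: "finite X"
begin

definition dec :: "bool list \<Rightarrow> nat \<times> nat \<times> 'a set list" where
  "dec = inv_into {(Z, M, cs). set cs \<subseteq> Pow X} (enc X)"

lemma dec_enc: "set cs \<subseteq> Pow X \<Longrightarrow> dec (enc X (Z, M, cs)) = (Z, M, cs)"
  unfolding dec_def by (rule inv_into_f_f[OF inj_on_enc[OF finX]]) simp

definition thr :: "'a set list \<Rightarrow> nat" where
  "thr w = max (2 ^ v) (tape_total X w)"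

definition next_state :: "nat \<Rightarrow> nat \<Rightarrow> bool list" where
  "next_state Z M = (if keep then enc X (Z, M, []) else enc X (0, 1, []))"

text \<open>While the tape is read, the memory \<open>(Z, M, cs)\<close> holds the cells read so far in reverse order;
  at the right end of the tape they are complete. The number \<open>Z\<close> is uniform on \<open>{..<M}\<close>, given the
  outputs so far. A move to the right at the right end only changes the memory.\<close>

definition sampler :: "'a sampler" where
  "sampler = \<lparr>init_state = enc X (0, 1, []),
     act = (\<lambda>m c. case dec m of (Z, M, cs) \<Rightarrow>
       (case c of
          Some a \<Rightarrow> Move_Right (enc X (Z, M, a # cs))
        | None \<Rightarrow>
           let w = rev cs; k = tape_total X w; q = M div k in
           if M < thr w then Toss (\<lambda>b. enc X (2 * Z + of_bool b, 2 * M, cs))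
           else if Z < q * k then
             (case slot X w (Z mod k) of (a, j) \<Rightarrow>
                Halt a (next_state (Z div k * wt w a + j) (q * wt w a)))
           else Move_Right (enc X (0, 1, cs))))\<rparr>"

lemma init_sampler [simp]: "init_state sampler = enc X (0, 1, [])"
  by (simp add: sampler_def)

lemma act_Some:
  "set cs \<subseteq> Pow X \<Longrightarrow> act sampler (enc X (Z, M, cs)) (Some a) = Move_Right (enc X (Z, M, a # cs))"
  by (simp add: sampler_def dec_enc)

lemma act_None:
  assumes "set w \<subseteq> Pow X"
  shows "act sampler (enc X (Z, M, rev w)) None =
    (if M < thr w then Toss (\<lambda>b. enc X (2 * Z + of_bool b, 2 * M, rev w))
     else if Z < M div tape_total X w * tape_total X w then
       (case slot X w (Z mod tape_total X w) of (a, j) \<Rightarrow>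
          Halt a (next_state (Z div tape_total X w * wt w a + j) (M div tape_total X w * wt w a)))
     else Move_Right (enc X (0, 1, rev w)))"
  using assms by (simp add: sampler_def dec_enc Let_def)

abbreviation "value_at \<equiv> value0 sampler X"

definition avg0 :: "(nat \<Rightarrow> real) \<Rightarrow> (nat \<Rightarrow> 'a \<Rightarrow> rat) \<Rightarrow> 'a list \<Rightarrow> nat \<Rightarrow> real" where
  "avg0 g p xs M = (\<Sum>Z<M. value_at g p xs (enc X (Z, M, []))) / real M"

lemma avg0_1: "avg0 g p xs 1 = value_at g p xs (enc X (0, 1, []))"
  by (simp add: avg0_def)

lemma sum_double: "(\<Sum>Z<2 * M. f Z) = (\<Sum>Z<M. f (2 * Z + 1) + f (2 * Z) :: real)" for M :: nat
  by (induction M) (simp_all add: algebra_simps)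

lemma sum_slot:
  fixes f :: "nat \<Rightarrow> real"
  assumes x: "x \<in> X" and k: "0 < tape_total X w"
  shows "(\<Sum>Z<q * tape_total X w. case slot X w (Z mod tape_total X w) of (a, j) \<Rightarrow>
      if a = x then f (Z div tape_total X w * wt w a + j) else 0) = (\<Sum>Z<q * wt w x. f Z)"
proof -
  let ?k = "tape_total X w"
  have block: "(\<Sum>Z=i * n..<i * n + n. F Z) = (\<Sum>u<n. F (i * n + u))" for F :: "nat \<Rightarrow> real" and i n
    using sum.shift_bounds_nat_ivl[of F 0 "i * n" n] by (simp add: add.commute lessThan_atLeast0)
  have "(\<Sum>Z<q * ?k. case slot X w (Z mod ?k) of (a, j) \<Rightarrow>
      if a = x then f (Z div ?k * wt w a + j) else 0) =
    (\<Sum>i<q. \<Sum>Z=i * ?k..<i * ?k + ?k. case slot X w (Z mod ?k) of (a, j) \<Rightarrow>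
      if a = x then f (Z div ?k * wt w a + j) else 0)"
    by (rule sum.nat_group[symmetric])
  also have "\<dots> = (\<Sum>i<q. \<Sum>Z=i * wt w x..<i * wt w x + wt w x. f Z)"
  proof (rule sum.cong[OF refl])
    fix i
    have "(\<Sum>Z=i * ?k..<i * ?k + ?k. case slot X w (Z mod ?k) of (a, j) \<Rightarrow>
        if a = x then f (Z div ?k * wt w a + j) else 0) =
      (\<Sum>u<?k. case slot X w u of (a, j) \<Rightarrow> if a = x then f (i * wt w a + j) else 0)"
      unfolding block using k by (intro sum.cong) (auto split: prod.splits)
    also have "\<dots> = (\<Sum>(a, j)\<in>(SIGMA a:X. {..<wt w a}). if a = x then f (i * wt w a + j) else 0)"
      using sum.reindex_bij_betw[OF bij_betw_slot[OF finX, of w],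
          of "\<lambda>(a, j). if a = x then f (i * wt w a + j) else 0"] .
    also have "\<dots> = (\<Sum>a\<in>X. \<Sum>j<wt w a. if a = x then f (i * wt w a + j) else 0)"
      using finX by (subst sum.Sigma) auto
    also have "\<dots> = (\<Sum>a\<in>X. if a = x then (\<Sum>j<wt w x. f (i * wt w x + j)) else 0)"
      by (rule sum.cong) auto
    also have "\<dots> = (\<Sum>j<wt w x. f (i * wt w x + j))" using x finX by simp
    also have "\<dots> = (\<Sum>Z=i * wt w x..<i * wt w x + wt w x. f Z)"
      by (rule block[symmetric])
    finally show "(\<Sum>Z=i * ?k..<i * ?k + ?k. case slot X w (Z mod ?k) of (a, j) \<Rightarrow>
        if a = x then f (Z div ?k * wt w a + j) else 0) =
      (\<Sum>Z=i * wt w x..<i * wt w x + wt w x. f Z)" .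
  qed
  also have "\<dots> = (\<Sum>Z<q * wt w x. f Z)" by (rule sum.nat_group)
  finally show ?thesis .
qed

end

locale recycler_round = recycler +
  fixes p :: "nat \<Rightarrow> 'a \<Rightarrow> rat" and x :: 'a and xs :: "'a list" and w :: "'a set list" and k :: nat
  assumes p0: "p 0 \<in> rat_dists X" and x: "x \<in> X"
  defines "w \<equiv> input_tape X (p 0)" and "k \<equiv> tape_total X w"
begin

abbreviation "p' \<equiv> \<lambda>i. p (Suc i)"

definition H :: "(nat \<Rightarrow> real) \<Rightarrow> nat \<Rightarrow> nat \<Rightarrow> real" where
  "H g Z M = val sampler X g p x xs (enc X (Z, M, rev w)) (length w)"

definition avg :: "(nat \<Rightarrow> real) \<Rightarrow> nat \<Rightarrow> real" where
  "avg g M = (\<Sum>Z<M. H g Z M) / real M"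

lemma k_pos: "0 < k" and w_Pow: "set w \<subseteq> Pow X"
  and p_wt: "of_rat (p 0 x) = real (wt w x) / real k"
  using total_input_tape_pos[OF finX p0] set_input_tape[OF finX p0] wt_input_tape[OF finX p0 x]
  by (simp_all add: w_def k_def)

lemma read_tape:
  assumes "h \<le> length w"
  shows "val sampler X g p x xs (enc X (Z, M, rev (take h w))) h = H g Z M"
  using assms
proof (induction h rule: inc_induct)
  case (step h)
  have "set (rev (take h w)) \<subseteq> Pow X" using w_Pow set_take_subset[of h w] by auto
  then have "act sampler (enc X (Z, M, rev (take h w))) (scan (input_tape X (p 0)) h) =
      Move_Right (enc X (Z, M, rev (take (Suc h) w)))"
    using step.hyps w_def by (simp add: act_Some take_Suc_conv_app_nth)
  from val_Move_Right[where p = p, OF this] show ?case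
    using step by (simp add: w_def[symmetric] min_def)
qed (simp add: H_def)

lemma value0_eq_H: "value_at g p (x # xs) (enc X (Z, M, [])) = H g Z M"
  using read_tape[of 0] by (simp add: value0_Cons)

lemma avg0_eq_avg: "avg0 g p (x # xs) M = avg g M"
  by (simp add: avg0_def avg_def value0_eq_H)

lemma act_end: "act sampler (enc X (Z, M, rev w)) (scan (input_tape X (p 0)) (length w)) =
    (if M < thr w then Toss (\<lambda>b. enc X (2 * Z + of_bool b, 2 * M, rev w))
     else if Z < M div k * k then
       (case slot X w (Z mod k) of (a, j) \<Rightarrow>
          Halt a (next_state (Z div k * wt w a + j) (M div k * wt w a)))
     else Move_Right (enc X (0, 1, rev w)))"
  using act_None[OF w_Pow] by (simp add: w_def[symmetric] k_def[symmetric])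

lemma H_Toss:
  assumes "M < thr w"
  shows "H (\<lambda>_. 1) Z M = (H (\<lambda>_. 1) (2 * Z + 1) (2 * M) + H (\<lambda>_. 1) (2 * Z) (2 * M)) / 2"
    and "H (capped K) Z M \<le>
      H (\<lambda>_. 1) Z M + (H (capped K) (2 * Z + 1) (2 * M) + H (capped K) (2 * Z) (2 * M)) / 2"
proof -
  have a: "act sampler (enc X (Z, M, rev w)) (scan (input_tape X (p 0)) (length w)) =
      Toss (\<lambda>b. enc X (2 * Z + of_bool b, 2 * M, rev w))"
    using act_end assms by simp
  show "H (\<lambda>_. 1) Z M = (H (\<lambda>_. 1) (2 * Z + 1) (2 * M) + H (\<lambda>_. 1) (2 * Z) (2 * M)) / 2"
    using val_Toss_prob[where p = p, OF a] by (simp add: H_def)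
  show "H (capped K) Z M \<le>
      H (\<lambda>_. 1) Z M + (H (capped K) (2 * Z + 1) (2 * M) + H (capped K) (2 * Z) (2 * M)) / 2"
    using val_Toss_capped[where p = p, OF a] by (simp add: H_def)
qed

lemma avg_Toss_prob:
  assumes "M < thr w"
  shows "avg (\<lambda>_. 1) M = avg (\<lambda>_. 1) (2 * M)"
  unfolding avg_def H_Toss(1)[OF assms] sum_double by (simp add: sum_divide_distrib[symmetric])

lemma avg_Toss_capped:
  assumes "M < thr w" "0 < M"
  shows "avg (capped K) M \<le> avg (\<lambda>_. 1) M + avg (capped K) (2 * M)"
proof -
  have "(\<Sum>Z<M. H (capped K) Z M) \<le>
      (\<Sum>Z<M. H (\<lambda>_. 1) Z M + (H (capped K) (2 * Z + 1) (2 * M) + H (capped K) (2 * Z) (2 * M)) / 2)"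
    by (intro sum_mono H_Toss(2)[OF assms(1)])
  also have "\<dots> = (\<Sum>Z<M. H (\<lambda>_. 1) Z M) + (\<Sum>Z<2 * M. H (capped K) Z (2 * M)) / 2"
    unfolding sum_double by (simp add: sum.distrib sum_divide_distrib[symmetric])
  finally have "(\<Sum>Z<M. H (capped K) Z M) / real M \<le>
      ((\<Sum>Z<M. H (\<lambda>_. 1) Z M) + (\<Sum>Z<2 * M. H (capped K) Z (2 * M)) / 2) / real M"
    by (rule divide_right_mono) simp
  then show ?thesis by (simp add: avg_def add_divide_distrib mult.commute)
qed

definition cont :: "(nat \<Rightarrow> real) \<Rightarrow> nat \<Rightarrow> real" where
  "cont g M = avg0 g p' xs (if keep then M else 1)"

definition miss :: "nat \<Rightarrow> real" where
  "miss M = real (M mod k) / real M"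

lemma miss_bounds:
  assumes "thr w \<le> M"
  shows "0 \<le> miss M" "miss M < 1" "0 < M" "miss M \<le> real k / 2 ^ v"
    "(1 - miss M) * of_rat (p 0 x) * real M = real (M div k * wt w x)"
proof -
  have M: "k \<le> M" "2 ^ v \<le> M" using assms by (auto simp: thr_def k_def)
  then show pos: "0 < M" using k_pos by simp
  show "0 \<le> miss M" by (simp add: miss_def)
  have "M mod k < k" using k_pos by simp
  then show "miss M < 1" using M(1) pos by (simp add: miss_def divide_less_eq)
  show "miss M \<le> real k / 2 ^ v"
    unfolding miss_def
  proof (rule frac_le)
    show "2 ^ v \<le> real M" using M(2) by (metis of_nat_le_iff of_nat_numeral of_nat_power)
  qed (use \<open>M mod k < k\<close> in auto)
  have "real (M div k) * real k + real (M mod k) = real M"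
    by (metis div_mult_mod_eq of_nat_add of_nat_mult)
  moreover have "(1 - miss M) * real M = real M - real (M mod k)"
    using pos by (simp add: miss_def left_diff_distrib)
  ultimately have e: "(1 - miss M) * real M = real (M div k) * real k" by linarith
  have "(1 - miss M) * of_rat (p 0 x) * real M = ((1 - miss M) * real M) * of_rat (p 0 x)"
    by (simp only: mult_ac)
  then show "(1 - miss M) * of_rat (p 0 x) * real M = real (M div k * wt w x)"
    using k_pos unfolding e p_wt by simp
qed

lemma H_Halt:
  assumes "thr w \<le> M"
  shows "H g Z M = (if Z < M div k * k then
       (case slot X w (Z mod k) of (a, j) \<Rightarrow>
          if a = x then value_at g p' xs (next_state (Z div k * wt w a + j) (M div k * wt w a)) else 0)
     else H g 0 1)"
proof (cases "Z < M div k * k")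
  case True
  obtain a j where aj: "slot X w (Z mod k) = (a, j)" by (cases "slot X w (Z mod k)")
  have "act sampler (enc X (Z, M, rev w)) (scan (input_tape X (p 0)) (length w)) =
      Halt a (next_state (Z div k * wt w a + j) (M div k * wt w a))"
    using True assms aj act_end by simp
  from val_Halt[where p = p, OF this] show ?thesis using True aj by (simp add: H_def)
next
  case False
  then have "act sampler (enc X (Z, M, rev w)) (scan (input_tape X (p 0)) (length w)) =
      Move_Right (enc X (0, 1, rev w))"
    using assms act_end by simp
  from val_Move_Right[where p = p, OF this] show ?thesis using False by (simp add: H_def w_def)
qed

lemma sum_next_state:
  "(\<Sum>Z<M. value_at g p' xs (next_state Z M)) = real M * cont g M"
  unfolding next_state_def cont_def avg0_def by (cases "M = 0") auto

lemma avg_Halt: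
  assumes "thr w \<le> M"
  shows "avg g M = (1 - miss M) * of_rat (p 0 x) * cont g (M div k * wt w x) + miss M * avg g 1"
proof -
  note b = miss_bounds[OF assms]
  let ?q = "M div k"
  have M: "{..<M} = {..<?q * k} \<union> {?q * k..<M}"
    by (auto simp: ivl_disj_un)
  have "(\<Sum>Z<M. H g Z M) = (\<Sum>Z<?q * k. H g Z M) + (\<Sum>Z=?q * k..<M. H g Z M)"
    by (subst M, rule sum.union_disjoint) auto
  also have "(\<Sum>Z<?q * k. H g Z M) = (\<Sum>Z<?q * k. case slot X w (Z mod k) of (a, j) \<Rightarrow>
      if a = x then value_at g p' xs (next_state (Z div k * wt w a + j) (?q * wt w x)) else 0)"
    by (rule sum.cong) (auto simp: H_Halt[OF assms] split: prod.splits)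
  also have "\<dots> = (\<Sum>Z<?q * wt w x. value_at g p' xs (next_state Z (?q * wt w x)))"
    by (rule sum_slot[OF x, of w, folded k_def, OF k_pos])
  also have "\<dots> = real (?q * wt w x) * cont g (?q * wt w x)"
    by (rule sum_next_state)
  also have "(\<Sum>Z=?q * k..<M. H g Z M) = real (M mod k) * H g 0 1"
    by (simp add: H_Halt[OF assms] minus_div_mult_eq_mod)
  finally have "(\<Sum>Z<M. H g Z M) =
      (1 - miss M) * of_rat (p 0 x) * real M * cont g (?q * wt w x) + real (M mod k) * avg g 1"
    unfolding b(5) by (simp add: avg_def)
  moreover have "real (M mod k) = miss M * real M" using b(3) by (simp add: miss_def)
  ultimately have "(\<Sum>Z<M. H g Z M) =
      ((1 - miss M) * of_rat (p 0 x) * cont g (?q * wt w x) + miss M * avg g 1) * real M"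
    by (simp add: algebra_simps)
  then show ?thesis
    using b(3) by (simp add: avg_def[of g M])
qed

lemma avg_prob_reach:
  assumes "0 < M" shows "\<exists>N\<ge>thr w. avg (\<lambda>_. 1) M = avg (\<lambda>_. 1) N"
  using assms
proof (induction "thr w - M" arbitrary: M rule: less_induct)
  case less
  show ?case
  proof (cases "M < thr w")
    case True
    then show ?thesis using less.hyps[of "2 * M"] less.prems avg_Toss_prob[OF True] by auto
  qed (auto intro: exI[of _ M])
qed

lemma avg_prob:
  assumes cont: "\<And>M. 0 < M \<Longrightarrow> cont (\<lambda>_. 1) M = P" and "0 < M"
  shows "avg (\<lambda>_. 1) M = of_rat (p 0 x) * P"
proof -
  have halt: "avg (\<lambda>_. 1) N = (1 - miss N) * (of_rat (p 0 x) * P) + miss N * avg (\<lambda>_. 1) 1"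
    if "thr w \<le> N" for N
  proof (cases "wt w x = 0")
    case True
    then show ?thesis using avg_Halt[OF that] p_wt by simp
  next
    case False
    have "k \<le> N" using that by (simp add: thr_def k_def)
    then have "0 < N div k * wt w x" using False k_pos by (simp add: div_greater_zero_iff)
    from cont[OF this] show ?thesis using avg_Halt[OF that] by simp
  qed
  obtain N where N: "thr w \<le> N" "avg (\<lambda>_. 1) 1 = avg (\<lambda>_. 1) N"
    using avg_prob_reach[of 1] by auto
  have "(1 - miss N) * (avg (\<lambda>_. 1) 1 - of_rat (p 0 x) * P) = 0"
    using halt[OF N(1)] N(2) by (simp add: algebra_simps)
  then have one: "avg (\<lambda>_. 1) 1 = of_rat (p 0 x) * P"
    using miss_bounds(2)[OF N(1)] by simp
  obtain N where N: "thr w \<le> N" "avg (\<lambda>_. 1) M = avg (\<lambda>_. 1) N"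
    using avg_prob_reach[OF assms(2)] by auto
  then show ?thesis using halt[OF N(1)] one by (simp add: algebra_simps)
qed

end

context recycler
begin

lemma avg0_prob:
  assumes "\<And>i. p i \<in> rat_dists X" "set xs \<subseteq> X" "0 < M"
  shows "avg0 (\<lambda>_. 1) p xs M = (\<Prod>i<length xs. of_rat (p i (xs ! i)))"
  using assms
proof (induction xs arbitrary: p M)
  case Nil
  then show ?case by (simp add: avg0_def)
next
  case (Cons x xs)
  interpret recycler_round X v keep p x xs "input_tape X (p 0)" "tape_total X (input_tape X (p 0))"
    using Cons.prems by unfold_locales auto
  have "avg0 (\<lambda>_. 1) p' xs M = (\<Prod>i<length xs. of_rat (p (Suc i) (xs ! i)))" if "0 < M" for M
    using Cons.prems that by (intro Cons.IH) auto
  then have "cont (\<lambda>_. 1) M = (\<Prod>i<length xs. of_rat (p (Suc i) (xs ! i)))" if "0 < M" for M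
    using that by (simp add: cont_def)
  from avg_prob[OF this] Cons.prems(3) show ?case
    by (simp add: avg0_eq_avg prod.lessThan_Suc_shift del: prod.lessThan_Suc)
qed

lemma online: "online_sampler X sampler"
proof (rule online_samplerI[OF finX])
  fix p :: "nat \<Rightarrow> 'a \<Rightarrow> rat" and xs assume "\<And>i. p i \<in> rat_dists X" "set xs \<subseteq> X"
  from avg0_prob[OF this, of 1] show "value_at (\<lambda>_. 1) p xs (init_state sampler) =
      (\<Prod>i<length xs. of_rat (p i (xs ! i)))"
    by (simp add: avg0_1[unfolded One_nat_def])
qed

end

lemma log_inverse_le:
  fixes t :: real
  assumes "0 \<le> t" "t \<le> 1 / 2"
  shows "log 2 (1 / (1 - t)) \<le> 4 * t"
proof -
  have "ln (1 / (1 - t)) \<le> 1 / (1 - t) - 1"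
    using assms by (intro ln_le_minus_one) simp
  also have "\<dots> = t / (1 - t)" using assms by (simp add: field_simps)
  also have "\<dots> \<le> t / (1 / 2)" using assms by (intro divide_left_mono) auto
  finally have l: "ln (1 / (1 - t)) \<le> 2 * t" by simp
  have "1 / 2 \<le> ln (2 :: real)" using ln_2_less_1 ln2_ge_two_thirds by linarith
  then have "ln (1 / (1 - t)) / ln 2 \<le> (2 * t) / (1 / 2)"
    using l assms by (intro frac_le) auto
  then show ?thesis by (simp add: log_def)
qed

text \<open>The recursion for the cost: \<open>h\<close> belongs to a round started from the state \<open>(0, 1)\<close>,
  \<open>c\<close> to one started with \<open>2 powr lg\<close> equally likely states, and \<open>\<rho>\<^sub>0\<close> and \<open>\<rho>\<close> are the
  probabilities that the first draw is rejected.\<close>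

lemma recycling_loss:
  fixes P :: real
  assumes "0 < P" "0 \<le> \<rho>" "\<rho> \<le> r" "0 \<le> \<rho>\<^sub>0" "\<rho>\<^sub>0 \<le> r" "r \<le> 1 / 2" "lg \<le> v + 1" "0 \<le> v"
    and h: "h \<le> P * v + (1 - \<rho>\<^sub>0) * P * (Q - v + log 2 (1 / (1 - \<rho>\<^sub>0))) + \<rho>\<^sub>0 * h"
    and c: "c \<le> (1 - \<rho>) * P * (Q - lg + log 2 (1 / (1 - \<rho>))) + \<rho> * h"
  shows "c \<le> P * (Q - lg + r * (2 * v + 7))"
proof -
  have half: "1 / 2 \<le> 1 - \<rho>\<^sub>0" "\<rho> \<le> 1 / 2" using assms by auto
  have "(1 - \<rho>\<^sub>0) * h \<le> P * v + (1 - \<rho>\<^sub>0) * P * (Q - v + 4 * \<rho>\<^sub>0)"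
  proof -
    have "(1 - \<rho>\<^sub>0) * P * (Q - v + log 2 (1 / (1 - \<rho>\<^sub>0))) \<le> (1 - \<rho>\<^sub>0) * P * (Q - v + 4 * \<rho>\<^sub>0)"
      using assms half log_inverse_le[of \<rho>\<^sub>0] by (intro mult_left_mono) auto
    then show ?thesis using h by (simp add: algebra_simps)
  qed
  also have "\<dots> = (1 - \<rho>\<^sub>0) * (P * (Q + 4 * \<rho>\<^sub>0)) + P * v * \<rho>\<^sub>0" by (simp add: algebra_simps)
  also have "\<dots> \<le> (1 - \<rho>\<^sub>0) * (P * (Q + 4 * \<rho>\<^sub>0)) + (1 - \<rho>\<^sub>0) * (2 * (P * v * \<rho>\<^sub>0))"
    using mult_right_mono[OF half(1), of "2 * (P * v * \<rho>\<^sub>0)"] assms by simp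
  also have "\<dots> = (1 - \<rho>\<^sub>0) * (P * (Q + 4 * \<rho>\<^sub>0 + 2 * v * \<rho>\<^sub>0))" by (simp add: algebra_simps)
  finally have "h \<le> P * (Q + 4 * \<rho>\<^sub>0 + 2 * v * \<rho>\<^sub>0)"
    using half(1) by (simp add: mult_le_cancel_left)
  also have "\<dots> \<le> P * (Q + (v + 2))"
  proof (intro mult_left_mono)
    have "(4 + 2 * v) * \<rho>\<^sub>0 \<le> (4 + 2 * v) * (1 / 2)" using assms by (intro mult_left_mono) auto
    then show "Q + 4 * \<rho>\<^sub>0 + 2 * v * \<rho>\<^sub>0 \<le> Q + (v + 2)" by (simp add: algebra_simps)
  qed (use assms in simp)
  finally have h': "h \<le> P * (Q + (v + 2))" .
  have "c \<le> (1 - \<rho>) * P * (Q - lg + 4 * \<rho>) + \<rho> * (P * (Q + (v + 2)))"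
  proof -
    have "(1 - \<rho>) * P * (Q - lg + log 2 (1 / (1 - \<rho>))) \<le> (1 - \<rho>) * P * (Q - lg + 4 * \<rho>)"
      using assms half log_inverse_le[of \<rho>] by (intro mult_left_mono) auto
    moreover have "\<rho> * h \<le> \<rho> * (P * (Q + (v + 2)))" using h' assms by (intro mult_left_mono)
    ultimately show ?thesis using c by linarith
  qed
  also have "\<dots> = P * (Q - lg + (4 * \<rho> - 4 * \<rho> * \<rho> + \<rho> * lg + \<rho> * (v + 2)))"
    by (simp add: algebra_simps)
  also have "\<dots> \<le> P * (Q - lg + r * (2 * v + 7))"
  proof (intro mult_left_mono add_left_mono)
    have "\<rho> * lg \<le> \<rho> * (v + 1)" "0 \<le> \<rho> * \<rho>" "\<rho> * (2 * v + 7) \<le> r * (2 * v + 7)"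
      using assms by (auto intro: mult_left_mono mult_right_mono)
    moreover have "4 * \<rho> - 4 * \<rho> * \<rho> + \<rho> * lg + \<rho> * (v + 2) =
        \<rho> * (2 * v + 7) - 4 * (\<rho> * \<rho>) + (\<rho> * lg - \<rho> * (v + 1))"
      by (simp add: algebra_simps)
    ultimately show "4 * \<rho> - 4 * \<rho> * \<rho> + \<rho> * lg + \<rho> * (v + 2) \<le> r * (2 * v + 7)"
      by linarith
  qed (use assms in simp)
  finally show ?thesis .
qed

context recycler_round
begin

lemma avg_doubling:
  assumes prob: "\<And>M. 0 < M \<Longrightarrow> avg (\<lambda>_. 1) M = P" and "0 < M" "M * 2 ^ j < 2 ^ Suc v"
  shows "avg (capped K) M \<le> P * real j + avg (capped K) (M * 2 ^ j)"
  using assms(3)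
proof (induction j)
  case (Suc j)
  have M: "M * 2 ^ j < 2 ^ v" using Suc.prems by simp
  then have "avg (capped K) (M * 2 ^ j) \<le> P + avg (capped K) (M * 2 ^ Suc j)"
    using avg_Toss_capped[of "M * 2 ^ j" K] prob[of "M * 2 ^ j"] assms(2)
    by (simp add: thr_def mult_ac)
  then show ?case using Suc M by (simp add: algebra_simps)
qed simp

lemma doubling_reach:
  fixes M :: nat
  assumes "0 < M" "M < 2 ^ Suc v"
  shows "\<exists>j. 2 ^ v \<le> M * 2 ^ j \<and> M * 2 ^ j < 2 ^ Suc v"
  using assms
proof (induction "2 ^ v - M" arbitrary: M rule: less_induct)
  case less
  show ?case
  proof (cases "M < 2 ^ v")
    case True
    then have "2 ^ v - 2 * M < 2 ^ v - M" "0 < 2 * M" "2 * M < 2 ^ Suc v"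
      using less.prems by (simp_all add: diff_less_mono2)
    from less.hyps[OF this] obtain j where "2 ^ v \<le> 2 * M * 2 ^ j \<and> 2 * M * 2 ^ j < 2 ^ Suc v"
      by blast
    then show ?thesis by (intro exI[of _ "Suc j"]) (simp add: mult_ac)
  next
    case False
    then show ?thesis using less.prems by (intro exI[of _ 0]) simp
  qed
qed

end

context recycler
begin

lemma tape_total_le:
  assumes "p \<in> rat_dists_upto X d" "2 * d \<le> 2 ^ v"
  shows "tape_total X (input_tape X p) \<le> d" "thr (input_tape X p) = 2 ^ v"
proof -
  show "tape_total X (input_tape X p) \<le> d"
    using assms(1) total_input_tape[OF finX, of p] by (simp add: rat_dists_upto_def)
  then show "thr (input_tape X p) = 2 ^ v" using assms(2) by (simp add: thr_def)
qed

lemma avg0_cost: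
  assumes keep and d: "2 * d \<le> 2 ^ v"
    and "\<And>i. p i \<in> rat_dists_upto X d" "set xs \<subseteq> X" "\<And>i. i < length xs \<Longrightarrow> 0 < p i (xs ! i)"
    and "0 < M" "M < 2 ^ Suc v"
  shows "avg0 (capped K) p xs M \<le> (\<Prod>i<length xs. of_rat (p i (xs ! i))) *
    ((\<Sum>i<length xs. log 2 (1 / of_rat (p i (xs ! i))))
      + real (length xs) * (real d / 2 ^ v * (2 * real v + 7)) + (real v + 1) - log 2 (real M))"
  using assms(3-)
proof (induction xs arbitrary: p M)
  case Nil
  have "log 2 (real M) < real (Suc v)"
    using Nil.prems by (intro log2_of_power_less) auto
  then show ?case using Nil.prems by (simp add: avg0_def capped_def)
next
  case (Cons x xs)
  have dists: "\<And>i. p i \<in> rat_dists X" using Cons.prems(1) by (simp add: rat_dists_upto_def)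
  interpret recycler_round X v keep p x xs "input_tape X (p 0)" "tape_total X (input_tape X (p 0))"
    using Cons.prems dists by unfold_locales auto
  let ?w = "input_tape X (p 0)" and ?k = "tape_total X (input_tape X (p 0))"
  define e where "e = real d / 2 ^ v * (2 * real v + 7)"
  define px :: real where "px = of_rat (p 0 x)"
  define P' :: real where "P' = (\<Prod>i<length xs. of_rat (p (Suc i) (xs ! i)))"
  define Q where "Q = (\<Sum>i<length xs. log 2 (1 / of_rat (p (Suc i) (xs ! i)))) + real (length xs) * e
    + (real v + 1) + log 2 (1 / px)"
  have pos: "0 < p (Suc i) (xs ! i)" if "i < length xs" for i
    using Cons.prems(3)[of "Suc i"] that by simp
  have px: "0 < px" using Cons.prems(3)[of 0] by (simp add: px_def)
  have P': "0 < P'" unfolding P'_def using pos by (intro prod_pos) auto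
  have kd: "?k \<le> d" and thr: "thr ?w = 2 ^ v" using tape_total_le[OF Cons.prems(1) d] by auto
  have wtx: "0 < wt ?w x" using px p_wt by (auto simp: px_def zero_less_divide_iff)
  have wt_le: "wt ?w x \<le> ?k" unfolding tape_total_def using finX x by (intro member_le_sum) auto
  have prob: "avg (\<lambda>_. 1) N = px * P'" if "0 < N" for N
    using avg0_prob[where p = p, OF dists Cons.prems(2) that]
    by (simp add: avg0_eq_avg px_def P'_def prod.lessThan_Suc_shift del: prod.lessThan_Suc)
  have rho: "0 \<le> miss N" "miss N \<le> real d / 2 ^ v" "miss N < 1" "0 < N" if "2 ^ v \<le> N" for N
  proof -
    have t: "thr ?w \<le> N" using that thr by simp
    show "0 \<le> miss N" "miss N < 1" "0 < N" using miss_bounds[OF t] by auto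
    have "real ?k / 2 ^ v \<le> real d / 2 ^ v" using kd by (intro divide_right_mono) auto
    then show "miss N \<le> real d / 2 ^ v" using miss_bounds(4)[OF t] by linarith
  qed
  have r: "real d / 2 ^ v \<le> 1 / 2"
  proof -
    have "real (2 * d) \<le> real (2 ^ v)" using d by (simp only: of_nat_le_iff)
    then show ?thesis by (simp add: field_simps)
  qed
  define c where "c = (\<lambda>N. avg (capped K) N)"
  have halt: "c N \<le> (1 - miss N) * (px * P') * (Q - log 2 (real N) + log 2 (1 / (1 - miss N))) + miss N * c 1"
    if N: "2 ^ v \<le> N" "N < 2 ^ Suc v" for N
  proof -
    have t: "thr ?w \<le> N" using N thr by simp
    note b = miss_bounds[OF t]
    let ?N = "N div ?k * wt ?w x"
    have "?k \<le> N" using t by (simp add: thr_def)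
    then have N0: "0 < ?N" using wtx k_pos by (simp add: div_greater_zero_iff)
    have "?N \<le> N div ?k * ?k" using wt_le by simp
    also have "\<dots> \<le> N" by simp
    finally have N1: "?N < 2 ^ Suc v" using N(2) by linarith
    have "cont (capped K) ?N = avg0 (capped K) p' xs ?N"
      unfolding cont_def by (subst if_P[OF \<open>keep\<close>]) simp
    also have "\<dots> \<le> P' * ((\<Sum>i<length xs. log 2 (1 / of_rat (p (Suc i) (xs ! i)))) +
        real (length xs) * e + (real v + 1) - log 2 (real ?N))"
      unfolding P'_def using Cons.prems pos N0 N1 by (intro Cons.IH[folded e_def]) auto
    also have "log 2 (real ?N) = log 2 (1 - miss N) + log 2 px + log 2 (real N)"
      unfolding b(5)[symmetric, folded px_def] using px b by (simp add: log_mult)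
    also have "\<dots> = log 2 (real N) - log 2 (1 / px) - log 2 (1 / (1 - miss N))"
      using px b by (simp add: log_divide)
    finally have "cont (capped K) ?N \<le> P' * (Q - log 2 (real N) + log 2 (1 / (1 - miss N)))"
      by (simp add: Q_def algebra_simps)
    then have "(1 - miss N) * px * cont (capped K) ?N \<le>
        (1 - miss N) * px * (P' * (Q - log 2 (real N) + log 2 (1 / (1 - miss N))))"
      using b px by (intro mult_left_mono) auto
    then show ?thesis
      unfolding c_def using avg_Halt[OF t, of "capped K", folded px_def] by (simp add: mult_ac)
  qed
  have c1: "c 1 \<le> px * P' * real v + c (2 ^ v)"
    unfolding c_def using avg_doubling[OF prob, of 1 v K] by simp
  have h: "c 1 \<le> px * P' * real v + (1 - miss (2 ^ v)) * (px * P') *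
      (Q - real v + log 2 (1 / (1 - miss (2 ^ v)))) + miss (2 ^ v) * c 1"
    using c1 halt[of "2 ^ v"] by (simp add: log_nat_power)
  have bound: "c N \<le> px * P' * (Q - log 2 (real N) + e)" if N: "2 ^ v \<le> N" "N < 2 ^ Suc v" for N
  unfolding e_def
  proof (rule recycling_loss[OF _ _ _ _ _ r _ _ h halt[OF N]])
    show "log 2 (real N) \<le> real v + 1"
      using log2_of_power_less[of N "Suc v"] N rho(4)[OF N(1)] by simp
  qed (use px P' rho[OF N(1)] rho[of "2 ^ v"] in auto)
  obtain j where j: "2 ^ v \<le> M * 2 ^ j" "M * 2 ^ j < 2 ^ Suc v"
    using doubling_reach Cons.prems(4,5) by blast
  have "avg0 (capped K) p (x # xs) M \<le> px * P' * real j + c (M * 2 ^ j)"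
    unfolding avg0_eq_avg c_def using avg_doubling[OF prob _ j(2)] Cons.prems(4) by simp
  also have "\<dots> \<le> px * P' * real j + px * P' * (Q - log 2 (real (M * 2 ^ j)) + e)"
    using bound[OF j] by simp
  also have "log 2 (real (M * 2 ^ j)) = log 2 (real M) + real j"
    using Cons.prems(4) by (simp add: log_mult log_nat_power)
  also have "px * P' * real j + px * P' * (Q - (log 2 (real M) + real j) + e) =
      px * P' * (Q - log 2 (real M) + e)"
    by (simp add: algebra_simps)
  also have "Q - log 2 (real M) + e = (\<Sum>i<length (x # xs). log 2 (1 / of_rat (p i ((x # xs) ! i)))) +
      real (length (x # xs)) * e + (real v + 1) - log 2 (real M)"
    unfolding length_Cons sum.lessThan_Suc_shift by (simp add: Q_def px_def distrib_right)
  also have "px * P' = (\<Prod>i<length (x # xs). of_rat (p i ((x # xs) ! i)))"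
    unfolding length_Cons prod.lessThan_Suc_shift by (simp add: px_def P'_def)
  finally show ?case unfolding e_def .
qed

lemma value0_cost_forget:
  assumes nk: "\<not> keep" and d: "2 * d \<le> 2 ^ v"
    and "\<And>i. p i \<in> rat_dists_upto X d" "set xs \<subseteq> X"
  shows "value_at (capped K) p xs (enc X (0, 1, [])) \<le>
    (\<Prod>i<length xs. of_rat (p i (xs ! i))) * (2 * real v * real (length xs))"
  using assms(3-)
proof (induction xs arbitrary: p)
  case Nil
  then show ?case by (simp add: capped_def)
next
  case (Cons x xs)
  have dists: "\<And>i. p i \<in> rat_dists X" using Cons.prems(1) by (simp add: rat_dists_upto_def)
  interpret recycler_round X v keep p x xs "input_tape X (p 0)" "tape_total X (input_tape X (p 0))"
    using Cons.prems dists by unfold_locales auto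
  let ?w = "input_tape X (p 0)" and ?k = "tape_total X (input_tape X (p 0))"
  define px :: real where "px = of_rat (p 0 x)"
  define P' :: real where "P' = (\<Prod>i<length xs. of_rat (p (Suc i) (xs ! i)))"
  have nonneg: "0 \<le> p i a" if "a \<in> X" for i a
    using dists[of i] that by (auto simp: rat_dists_def)
  have px: "0 \<le> px" using nonneg Cons.prems(2) by (simp add: px_def)
  have P': "0 \<le> P'"
    unfolding P'_def using nonneg Cons.prems(2) by (intro prod_nonneg) (auto simp: subset_iff)
  have kd: "?k \<le> d" and thr: "thr ?w = 2 ^ v" using tape_total_le[OF Cons.prems(1) d] by auto
  have prob: "avg (\<lambda>_. 1) N = px * P'" if "0 < N" for N
    using avg0_prob[where p = p, OF dists Cons.prems(2) that]
    by (simp add: avg0_eq_avg px_def P'_def prod.lessThan_Suc_shift del: prod.lessThan_Suc)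
  have t: "thr ?w \<le> 2 ^ v" using thr by simp
  note b = miss_bounds[OF t]
  have r: "miss (2 ^ v) \<le> 1 / 2"
  proof -
    have "real (2 * ?k) \<le> real (2 ^ v)" using d kd by (simp only: of_nat_le_iff)
    then have "real ?k / 2 ^ v \<le> 1 / 2" by (simp add: field_simps)
    then show ?thesis using b(4) by linarith
  qed
  let ?h = "avg (capped K) 1" and ?\<rho> = "miss (2 ^ v)" and ?B = "P' * (2 * real v * real (length xs))"
  have cont: "cont (capped K) N \<le> ?B" for N
  proof -
    have "cont (capped K) N = value_at (capped K) p' xs (enc X (0, 1, []))"
      unfolding cont_def by (subst if_not_P[OF nk]) (rule avg0_1)
    also have "\<dots> \<le> ?B" unfolding P'_def using Cons.prems by (intro Cons.IH) auto
    finally show ?thesis .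
  qed
  have "?h \<le> px * P' * real v + avg (capped K) (2 ^ v)"
    using avg_doubling[OF prob, of 1 v K] by simp
  also have "avg (capped K) (2 ^ v) \<le> (1 - ?\<rho>) * px * ?B + ?\<rho> * ?h"
    unfolding avg_Halt[OF t] px_def[symmetric]
    using cont b px by (intro add_right_mono mult_left_mono) auto
  finally have "(1 - ?\<rho>) * ?h \<le> px * P' * real v + (1 - ?\<rho>) * (px * ?B)"
    by (simp add: algebra_simps)
  also have "\<dots> \<le> (1 - ?\<rho>) * (2 * (px * P' * real v)) + (1 - ?\<rho>) * (px * ?B)"
    using mult_right_mono[of "1 / 2" "1 - ?\<rho>" "2 * (px * P' * real v)"] r px P' by simp
  finally have "(1 - ?\<rho>) * ?h \<le> (1 - ?\<rho>) * (2 * (px * P' * real v) + px * ?B)"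
    by (simp add: algebra_simps)
  then have "?h \<le> 2 * (px * P' * real v) + px * ?B"
    using b(2) by (simp add: mult_le_cancel_left)
  then have "value_at (capped K) p (x # xs) (enc X (0, 1, [])) \<le> px * P' * (2 * real v * real (length (x # xs)))"
    unfolding avg0_eq_avg[symmetric] avg0_1 by (simp add: algebra_simps)
  then show ?case
    unfolding length_Cons prod.lessThan_Suc_shift by (simp add: px_def P'_def)
qed

definition states :: "bool list set" where
  "states = (if keep then {enc X (Z, M, []) |Z M. Z < M \<and> M < 2 ^ Suc v} else {enc X (0, 1, [])})"

definition configs :: "'a set list \<Rightarrow> (bool list \<times> nat) set" where
  "configs w = {(enc X (Z, M, rev (take h w)), h) |Z M h. Z < M \<and> M < 2 ^ Suc v \<and> h \<le> length w}"

lemma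
  assumes d: "2 * d \<le> 2 ^ v" and p: "\<And>i. p i \<in> rat_dists_upto X d"
    and run: "run sampler X p B n = Some (xs, s, t)"
  shows run_states: "s \<in> states"
    and steps_configs: "\<exists>h. (fst ((step sampler (input_tape X (p n)) B ^^ j) (s, 0, t)), h)
      \<in> configs (input_tape X (p n))"
proof -
  have P: "set (input_tape X (p n)) \<subseteq> Pow X" for n
    by (auto simp: input_tape_def)
  have thr: "thr (input_tape X (p n)) = 2 ^ v" for n using tape_total_le[OF p d] by simp
  have two: "(1 :: nat) < 2 ^ Suc v" by (rule one_less_power) simp_all
  have "enc X (0, 1, []) \<in> {enc X (Z, M, []) |Z M. Z < M \<and> M < 2 ^ Suc v}"
    by (rule CollectI, rule exI[of _ 0], rule exI[of _ 1]) (use two in simp)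
  then have init: "init_state sampler \<in> states"
    unfolding init_sampler states_def by (auto split: if_split)
  have start: "(s, 0) \<in> configs (input_tape X (p n))" if s: "s \<in> states" for s n
  proof -
    obtain Z M where "s = enc X (Z, M, [])" "Z < M" "M < 2 ^ Suc v"
    proof (cases keep)
      case True
      from s obtain Z M where "s = enc X (Z, M, [])" "Z < M" "M < 2 ^ Suc v"
        unfolding states_def if_P[OF True] by blast
      then show ?thesis by (rule that)
    next
      case False
      then have "s = enc X (0, 1, [])" using s unfolding states_def if_not_P[OF False] by simp
      then show ?thesis using two by (intro that[of 0 1]) auto
    qed
    then show ?thesis unfolding configs_def by force
  qed
  have step: "(m', h') \<in> configs (input_tape X (p n))"
    if mh: "(m, h) \<in> configs (input_tape X (p n))"
      and st: "step sampler (input_tape X (p n)) B (m, h, t) = (m', h', t')" for n m h t B m' h' t'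
  proof -
    let ?w = "input_tape X (p n)"
    from mh obtain Z M where m: "m = enc X (Z, M, rev (take h ?w))" "Z < M" "M < 2 ^ Suc v" "h \<le> length ?w"
      by (auto simp: configs_def)
    show ?thesis
    proof (cases "h < length ?w")
      case True
      have "set (rev (take h ?w)) \<subseteq> Pow X" using P set_take_subset[of h ?w] by auto
      then have "step sampler ?w B (m, h, t) = (enc X (Z, M, rev (take (Suc h) ?w)), Suc h, t)"
        using True by (simp add: m(1) act_Some take_Suc_conv_app_nth)
      then show ?thesis using st m True unfolding configs_def by fastforce
    next
      case False
      then have h: "h = length ?w" using m by simp
      have one: "(enc X (0, 1, rev ?w), length ?w) \<in> configs ?w"
        unfolding configs_def
        by (rule CollectI, rule exI[of _ 0], rule exI[of _ 1], rule exI[of _ "length ?w"]) (use two in simp)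
      have dbl: "(enc X (2 * Z + of_bool b, 2 * M, rev ?w), length ?w) \<in> configs ?w" if "M < 2 ^ v" for b
        using m(2) that unfolding configs_def
        by (intro CollectI exI[of _ "2 * Z + of_bool b"] exI[of _ "2 * M"] exI[of _ "length ?w"])
          (auto simp: of_bool_def)
      show ?thesis
        using st mh one dbl unfolding h m(1)
        by (auto simp: act_None[OF P] thr split: if_splits prod.splits)
    qed
  qed
  have halt: "s \<in> states"
    if mh: "(m, h) \<in> configs (input_tape X (p n))"
      and a: "act sampler m (scan (input_tape X (p n)) h) = Halt x s" for n m h x s
  proof -
    let ?w = "input_tape X (p n)" and ?k = "tape_total X (input_tape X (p n))"
    from mh obtain Z M where m: "m = enc X (Z, M, rev (take h ?w))" "Z < M" "M < 2 ^ Suc v" "h \<le> length ?w"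
      by (auto simp: configs_def)
    have "set (rev (take h ?w)) \<subseteq> Pow X" using P set_take_subset[of h ?w] by auto
    then have h: "h = length ?w"
      using a m by (auto simp: act_Some split: if_splits)
    obtain b j where bj: "slot X ?w (Z mod ?k) = (b, j)" by (cases "slot X ?w (Z mod ?k)")
    from a have Z: "Z < M div ?k * ?k" and s: "s = next_state (Z div ?k * wt ?w b + j) (M div ?k * wt ?w b)"
      unfolding m(1) h by (auto simp: act_None[OF P] bj split: if_splits)
    have k: "0 < ?k" using Z by (cases "?k = 0") auto
    have "slot X ?w (Z mod ?k) \<in> (SIGMA a:X. {..<wt ?w a})"
      using bij_betwE[OF bij_betw_slot[OF finX, of ?w]] k by simp
    then have b: "b \<in> X" and j: "j < wt ?w b" using bj by auto
    have "Z div ?k < M div ?k" using Z k by (simp add: div_less_iff_less_mult)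
    then have "Suc (Z div ?k) * wt ?w b \<le> M div ?k * wt ?w b" by (intro mult_right_mono) auto
    then have lt: "Z div ?k * wt ?w b + j < M div ?k * wt ?w b" using j by simp
    have "wt ?w b \<le> ?k" unfolding tape_total_def using finX b by (intro member_le_sum) auto
    then have "M div ?k * wt ?w b \<le> M div ?k * ?k" by simp
    also have "\<dots> \<le> M" by simp
    finally have "M div ?k * wt ?w b < 2 ^ Suc v" using m(3) by linarith
    with lt show ?thesis unfolding s next_state_def states_def by auto
  qed
  show "s \<in> states"
    by (rule run_invariant(1)[where R = "\<lambda>n. configs (input_tape X (p n))", OF init start step halt run])
  show "\<exists>h. (fst ((step sampler (input_tape X (p n)) B ^^ j) (s, 0, t)), h)
      \<in> configs (input_tape X (p n))"
    by (rule run_invariant(2)[where R = "\<lambda>n. configs (input_tape X (p n))", OF init start step halt run])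
qed

lemma carried_space:
  assumes "2 * d \<le> 2 ^ v" "\<And>i. p i \<in> rat_dists_upto X d"
    and b: "if keep then 2 * real v + 4 \<le> b else 2 \<le> b"
  shows "carried_space_le sampler X p b"
  unfolding carried_space_le_def
proof (intro allI impI)
  fix B n xs s t assume "run sampler X p B n = Some (xs, s, t)"
  from run_states[OF assms(1,2) this] have s: "s \<in> states" .
  show "real (length s) \<le> b"
  proof (cases keep)
    case True
    from s obtain Z M where "s = enc X (Z, M, [])" "Z < M" "M < 2 ^ Suc v"
      unfolding states_def if_P[OF True] by blast
    then have "length s \<le> 2 * v + 4" using length_enc_Nil by blast
    then show ?thesis using b unfolding if_P[OF True] by linarith
  next
    case False
    have "length s \<le> 2"
      using s length_enc_init[of X] unfolding states_def if_not_P[OF False] by simp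
    then show ?thesis using b unfolding if_not_P[OF False] by linarith
  qed
qed

lemma temp_space:
  assumes "2 * d \<le> 2 ^ v" "\<And>i. p i \<in> rat_dists_upto X d"
    and b: "4 * real v + 8 + 2 * (real (Suc (card X)) * (log 2 (real d) + 1)) \<le> b"
  shows "temp_space_le sampler X p b"
  unfolding temp_space_le_def
proof (intro allI impI)
  fix B n xs s t j assume run: "run sampler X p B n = Some (xs, s, t)"
  let ?w = "input_tape X (p n)" and ?m = "fst ((step sampler (input_tape X (p n)) B ^^ j) (s, 0, t))"
  from steps_configs[OF assms(1,2) run, of j] obtain Z M h where
    m: "?m = enc X (Z, M, rev (take h ?w))" "Z < M" "M < 2 ^ Suc v" "h \<le> length ?w"
    by (auto simp: configs_def)
  have "set (rev (take h ?w)) \<subseteq> Pow X"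
    using set_take_subset[of h ?w] by (auto simp: input_tape_def dest: in_set_takeD)
  from length_enc[OF finX m(2,3) this] m(4)
  have "length ?m \<le> 4 * v + 8 + 2 * (Suc (card X) * h)" unfolding m(1) by simp
  also have "\<dots> \<le> 4 * v + 8 + 2 * (Suc (card X) * length ?w)"
    using m(4) by (intro add_left_mono mult_left_mono) auto
  finally have "real (length ?m) \<le> real (4 * v + 8 + 2 * (Suc (card X) * length ?w))"
    by (simp only: of_nat_le_iff)
  also have "\<dots> = 4 * real v + 8 + 2 * (real (Suc (card X)) * real (length ?w))"
    by (simp add: algebra_simps)
  also have "\<dots> \<le> 4 * real v + 8 + 2 * (real (Suc (card X)) * (log 2 (real d) + 1))"
    using length_input_tape_le[OF finX assms(2)]
    by (intro add_left_mono mult_left_mono) auto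
  finally show "real (length ?m) \<le> b" using b by linarith
qed

end

section \<open>A sampler with bounded memory\<close>

text \<open>The head marches to the left, turning with probability \<open>1/3\<close> at each cell, and then back to
  the right end, replacing a remembered cell content \<open>y\<close> by the scanned one with probability \<open>1/4\<close>
  at each cell. The left end of the tape cannot be recognised, but a head that is stuck there
  just turns later. On a tape of length \<open>L\<close> the content of cell \<open>m\<close> is the one remembered in
  the end with probability \<open>1/4 * (2/3 * 3/4) ^ (L - 1 - m)\<close>, in proportion to \<open>2 ^ m\<close>, and this
  includes \<open>m = 0\<close>. The functions \<open>right_march\<close> and \<open>left_march\<close> are the expected values of
  \<open>\<Phi> y\<close> at the end when the head is at position \<open>h\<close> of a march in the respective direction.\<close>

definition march_tail :: "'a set list \<Rightarrow> ('a set \<Rightarrow> real) \<Rightarrow> nat \<Rightarrow> real" where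
  "march_tail w \<Phi> h = (\<Sum>m=h..<length w. (3/4) ^ (length w - 1 - m) * (\<Phi> (w ! m) - \<Phi> {})) / 4"

definition right_march :: "'a set list \<Rightarrow> ('a set \<Rightarrow> real) \<Rightarrow> nat \<Rightarrow> 'a set \<Rightarrow> real" where
  "right_march w \<Phi> h y = \<Phi> {} + (3/4) ^ (length w - h) * (\<Phi> y - \<Phi> {}) + march_tail w \<Phi> h"

definition left_march :: "'a set list \<Rightarrow> ('a set \<Rightarrow> real) \<Rightarrow> nat \<Rightarrow> real" where
  "left_march w \<Phi> h = \<Phi> {} + march_tail w \<Phi> h +
     (2/3) ^ h * (3/4) ^ length w / 3 * (\<Sum>m<h. 2 ^ m * (\<Phi> (w ! m) - \<Phi> {}))"

lemma march_tail_step: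
  assumes "h < length w"
  shows "march_tail w \<Phi> h =
    march_tail w \<Phi> (Suc h) + (3/4) ^ (length w - 1 - h) * (\<Phi> (w ! h) - \<Phi> {}) / 4"
  using assms by (simp add: march_tail_def sum.atLeast_Suc_lessThan add_divide_distrib)

lemma right_march_end [simp]: "right_march w \<Phi> (length w) y = \<Phi> y"
  by (simp add: right_march_def march_tail_def)

lemma right_march_step:
  assumes "h < length w"
  shows "right_march w \<Phi> h y =
    3/4 * right_march w \<Phi> (Suc h) y + 1/4 * right_march w \<Phi> (Suc h) (w ! h)"
proof -
  have "length w - h = Suc (length w - Suc h)" "length w - 1 - h = length w - Suc h"
    using assms by auto
  then show ?thesis
    by (simp add: right_march_def march_tail_step[OF assms] field_simps)
qed

lemma left_march_0: "left_march w \<Phi> 0 = right_march w \<Phi> 0 {}"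
  by (simp add: left_march_def right_march_def)

lemma left_march_step:
  assumes "Suc h < length w"
  shows "left_march w \<Phi> (Suc h) = 2/3 * left_march w \<Phi> h + 1/3 * right_march w \<Phi> (Suc h) {}"
proof -
  let ?\<psi> = "\<Phi> (w ! h) - \<Phi> {}" and ?L = "length w"
  have "(2/3 :: real) ^ h * 2 ^ h * (3/4) ^ ?L = (3/4) ^ (?L - h)"
  proof -
    have "(3/4 :: real) ^ ?L = (3/4) ^ h * (3/4) ^ (?L - h)"
      using assms by (simp flip: power_add)
    then have "(2/3 :: real) ^ h * 2 ^ h * (3/4) ^ ?L = (2/3 * 2 * (3/4)) ^ h * (3/4) ^ (?L - h)"
      by (simp only: power_mult_distrib mult_ac)
    then show ?thesis by simp
  qed
  also have "\<dots> = 3/4 * (3/4) ^ (?L - 1 - h)"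
    using assms by (simp add: Suc_diff_Suc flip: power_Suc)
  finally have e: "(2/3 :: real) ^ h * 2 ^ h * (3/4) ^ ?L = 3/4 * (3/4) ^ (?L - 1 - h)" .
  have "(2/3) ^ Suc h * (3/4) ^ ?L / 3 * (2 ^ h * ?\<psi>) = 2/9 * ((2/3) ^ h * 2 ^ h * (3/4) ^ ?L) * ?\<psi>"
    by simp
  also have "\<dots> = (3/4) ^ (?L - 1 - h) * ?\<psi> / 6"
    unfolding e by simp
  finally have e2: "(2/3) ^ Suc h * (3/4) ^ ?L / 3 * (2 ^ h * ?\<psi>) = (3/4) ^ (?L - 1 - h) * ?\<psi> / 6" .
  have e3: "(2/3) ^ Suc h * (3/4) ^ ?L / 3 * (\<Sum>m<Suc h. 2 ^ m * (\<Phi> (w ! m) - \<Phi> {})) =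
      2/3 * ((2/3) ^ h * (3/4) ^ ?L / 3 * (\<Sum>m<h. 2 ^ m * (\<Phi> (w ! m) - \<Phi> {})))
        + (3/4) ^ (?L - 1 - h) * ?\<psi> / 6"
    unfolding sum.lessThan_Suc distrib_left[of "(2/3) ^ Suc h * (3/4) ^ ?L / 3"] e2 by simp
  have e4: "march_tail w \<Phi> h = march_tail w \<Phi> (Suc h) + (3/4) ^ (?L - 1 - h) * ?\<psi> / 4"
    using assms by (intro march_tail_step) simp
  have "a + t + (2/3 * d + q * u / 6) = 2/3 * (a + (t + q * u / 4) + d) + 1/3 * (a + c * (a - a) + t)"
    for a t d q u c :: real by (simp add: field_simps)
  then show ?thesis unfolding left_march_def right_march_def e3 e4 .
qed

lemma left_march_last:
  assumes "0 < length w"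
  shows "left_march w \<Phi> (length w - 1) =
    \<Phi> {} + (\<Sum>m<length w. 2 ^ m * (\<Phi> (w ! m) - \<Phi> {})) / 2 ^ Suc (length w)"
proof -
  obtain n where n: "length w = Suc n" using assms by (cases "length w") auto
  have "(2/3 :: real) ^ n * (3/4) ^ Suc n = 3/4 * (2/3 * (3/4)) ^ n"
    by (simp only: power_mult_distrib power_Suc mult_ac)
  also have "\<dots> = 3/4 / 2 ^ n" by (simp add: power_one_over)
  finally have D: "(2/3 :: real) ^ n * (3/4) ^ Suc n / 3 = 1 / 4 / 2 ^ n" by simp
  have T: "march_tail w \<Phi> n = (\<Phi> (w ! n) - \<Phi> {}) / 4"
    by (simp add: march_tail_def n)
  show ?thesis
    unfolding left_march_def n diff_Suc_1 D T sum.lessThan_Suc by (simp add: field_simps)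
qed

datatype 'a phase = Start | March_Left | March_Left2 | Go_Left | March_Right "'a set" | March_Right2 "'a set"
  | Go_Right "'a set" | Pick "'a set" nat nat

locale small_sampler =
  fixes X :: "'a set"
  assumes finX: "finite X"
begin

definition phases :: "'a phase set" where
  "phases = {Start, March_Left, March_Left2, Go_Left} \<union> March_Right ` Pow X \<union> March_Right2 ` Pow X \<union> Go_Right ` Pow X
     \<union> (\<lambda>(y, i, Z). Pick y Z i) ` (Pow X \<times> (SIGMA i:{..card X}. {..<2 ^ i}))"

lemma finite_phases: "finite phases"
  using finX by (simp add: phases_def)

definition code :: "'a phase \<Rightarrow> bool list" where
  "code s = replicate (if s = Start then 0 else Suc (to_nat_on phases s)) True"

definition decode :: "bool list \<Rightarrow> 'a phase" where
  "decode = inv_into phases code"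

lemma code_Start [simp]: "code Start = []"
  by (simp add: code_def)

lemma inj_to_nat: "inj_on (to_nat_on phases) phases"
  using to_nat_on_finite[OF finite_phases] by (simp add: bij_betw_def)

lemma decode_code: "s \<in> phases \<Longrightarrow> decode (code s) = s"
  unfolding decode_def
proof (rule inv_into_f_f)
  show "inj_on code phases"
    using inj_to_nat by (auto simp: inj_on_def code_def split: if_splits)
qed

lemma length_code_le: "s \<in> phases \<Longrightarrow> length (code s) \<le> card phases"
  using to_nat_on_finite[OF finite_phases] by (auto simp: code_def bij_betw_def Suc_le_eq)

text \<open>The tosses in the phases \<open>March_Left\<close> and \<open>March_Left2\<close>, repeated if both come out as
  \<open>False\<close>, implement the probability \<open>1/3\<close>; those in \<open>March_Right\<close> and \<open>March_Right2\<close> implement \<open>1/4\<close>.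
  At the right end, \<open>Pick\<close> chooses a symbol of the remembered cell, each with the same probability.\<close>

definition sampler :: "'a sampler" where
  "sampler = \<lparr>init_state = code Start,
     act = (\<lambda>m c. case decode m of
        Start \<Rightarrow> (case c of None \<Rightarrow> Move_Left (code March_Left) | Some _ \<Rightarrow> Move_Right (code Start))
      | March_Left \<Rightarrow> Toss (\<lambda>b. code (if b then Go_Left else March_Left2))
      | March_Left2 \<Rightarrow> Toss (\<lambda>b. code (if b then March_Right {} else March_Left))
      | Go_Left \<Rightarrow> Move_Left (code March_Left)
      | March_Right y \<Rightarrow> (case c of
            None \<Rightarrow> Move_Right (code (Pick y 0 0))
          | Some _ \<Rightarrow> Toss (\<lambda>b. code (if b then Go_Right y else March_Right2 y)))
      | March_Right2 y \<Rightarrow> (case c of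
            None \<Rightarrow> Move_Right (code Start)
          | Some a \<Rightarrow> Toss (\<lambda>b. code (Go_Right (if b then y else a \<inter> X))))
      | Go_Right y \<Rightarrow> Move_Right (code (March_Right y))
      | Pick y Z i \<Rightarrow>
          if i < card X then Toss (\<lambda>b. code (Pick y (2 * Z + of_bool b) (Suc i)))
          else if Z < card X \<and> from_nat_into X Z \<in> y then Halt (from_nat_into X Z) (code Start)
          else Move_Right (code Start))\<rparr>"

lemma init_sampler [simp]: "init_state sampler = []"
  by (simp add: sampler_def)

lemma Pick_phase: "y \<subseteq> X \<Longrightarrow> i \<le> card X \<Longrightarrow> Z < 2 ^ i \<Longrightarrow> Pick y Z i \<in> phases"
  unfolding phases_def by (intro UnI2 image_eqI[of _ _ "(y, i, Z)"]) auto

lemma phases_intros: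
  "Start \<in> phases" "March_Left \<in> phases" "March_Left2 \<in> phases" "Go_Left \<in> phases"
  "y \<subseteq> X \<Longrightarrow> March_Right y \<in> phases" "y \<subseteq> X \<Longrightarrow> March_Right2 y \<in> phases" "y \<subseteq> X \<Longrightarrow> Go_Right y \<in> phases"
  by (auto simp: phases_def)

lemma act_sampler:
  "act sampler (code Start) None = Move_Left (code March_Left)"
  "act sampler (code Start) (Some a) = Move_Right (code Start)"
  "act sampler (code March_Left) c = Toss (\<lambda>b. code (if b then Go_Left else March_Left2))"
  "act sampler (code March_Left2) c = Toss (\<lambda>b. code (if b then March_Right {} else March_Left))"
  "act sampler (code Go_Left) c = Move_Left (code March_Left)"
  "y \<subseteq> X \<Longrightarrow> act sampler (code (March_Right y)) None = Move_Right (code (Pick y 0 0))"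
  "y \<subseteq> X \<Longrightarrow> act sampler (code (March_Right y)) (Some a) = Toss (\<lambda>b. code (if b then Go_Right y else March_Right2 y))"
  "y \<subseteq> X \<Longrightarrow> act sampler (code (March_Right2 y)) (Some a) = Toss (\<lambda>b. code (Go_Right (if b then y else a \<inter> X)))"
  "y \<subseteq> X \<Longrightarrow> act sampler (code (March_Right2 y)) None = Move_Right (code Start)"
  "y \<subseteq> X \<Longrightarrow> act sampler (code (Go_Right y)) c = Move_Right (code (March_Right y))"
  "y \<subseteq> X \<Longrightarrow> i \<le> card X \<Longrightarrow> Z < 2 ^ i \<Longrightarrow> act sampler (code (Pick y Z i)) c =
     (if i < card X then Toss (\<lambda>b. code (Pick y (2 * Z + of_bool b) (Suc i)))
      else if Z < card X \<and> from_nat_into X Z \<in> y then Halt (from_nat_into X Z) (code Start)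
      else Move_Right (code Start))"
  by (simp_all add: sampler_def decode_code[OF phases_intros(1)] decode_code[OF phases_intros(2)]
      decode_code[OF phases_intros(3)] decode_code[OF phases_intros(4)]
      decode_code[OF phases_intros(5)] decode_code[OF phases_intros(6)]
      decode_code[OF phases_intros(7)] decode_code[OF Pick_phase] del: code_Start)

end

locale small_round = small_sampler +
  fixes p :: "nat \<Rightarrow> 'a \<Rightarrow> rat" and x :: 'a and xs :: "'a list" and w :: "'a set list" and k :: nat
  assumes p0: "p 0 \<in> rat_dists X" and x: "x \<in> X"
  defines "w \<equiv> input_tape X (p 0)" and "k \<equiv> tape_total X w"
begin

abbreviation "p' \<equiv> \<lambda>i. p (Suc i)"

definition V :: "(nat \<Rightarrow> real) \<Rightarrow> 'a phase \<Rightarrow> nat \<Rightarrow> real" where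
  "V g s h = val sampler X g p x xs (code s) h"

definition v0 :: "(nat \<Rightarrow> real) \<Rightarrow> real" where
  "v0 g = value0 sampler X g p' xs []"

definition one :: "nat \<Rightarrow> real" where "one = (\<lambda>_. 1)"

lemma bounded_reward_one: "bounded_reward one"
  by (simp add: one_def)

lemma k_pos: "0 < k" and w_Pow: "set w \<subseteq> Pow X"
  and p_wt: "of_rat (p 0 x) = real (wt w x) / real k" and w_pos: "0 < length w"
  and k_ge: "2 ^ (length w - 1) \<le> k"
  using total_input_tape_pos[OF finX p0] set_input_tape[OF finX p0] wt_input_tape[OF finX p0 x]
    length_input_tape_pos[OF finX p0] total_input_tape_ge[OF finX p0]
  by (simp_all add: w_def k_def)

lemma cell_Pow: "h < length w \<Longrightarrow> w ! h \<subseteq> X" "h < length w \<Longrightarrow> w ! h \<inter> X = w ! h"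
  using w_Pow nth_mem[of h w] by blast+

lemma V_nonneg: "bounded_reward g \<Longrightarrow> 0 \<le> V g s h"
  unfolding V_def by (rule val_nonneg)

lemma V_Toss:
  assumes "act sampler (code s) (scan w h) = Toss (\<lambda>b. code (f b))"
  shows "V one s h = (V one (f True) h + V one (f False) h) / 2"
    and "V (capped K) s h \<le> V one s h + (V (capped K) (f True) h + V (capped K) (f False) h) / 2"
  using val_Toss_prob[where p = p, OF assms[unfolded w_def]]
    val_Toss_capped[where p = p, OF assms[unfolded w_def]] unfolding V_def one_def by auto

lemma V_Left_move:
  "act sampler (code s) (scan w h) = Move_Left (code s') \<Longrightarrow> V g s h = V g s' (h - 1)"
  unfolding V_def w_def by (rule val_Move_Left)

lemma V_Right_move:
  "act sampler (code s) (scan w h) = Move_Right (code s') \<Longrightarrow> V g s h = V g s' (min (Suc h) (length w))"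
  unfolding V_def w_def by (rule val_Move_Right)

definition R :: "(nat \<Rightarrow> real) \<Rightarrow> real" where
  "R g = V g March_Left (length w - 1)"

lemma V_Start:
  assumes "h \<le> length w" shows "V g Start h = R g"
  using assms
proof (induction h rule: inc_induct)
  case base
  show ?case using V_Left_move[of Start "length w" March_Left g] act_sampler(1) by (simp add: R_def)
next
  case (step h)
  then show ?case using V_Right_move[of Start h Start g] act_sampler(2) by (simp add: min_def)
qed

lemma value0_eq_R: "value0 sampler X g p (x # xs) [] = R g"
  using V_Start[of 0 g] by (simp add: value0_Cons V_def)

definition \<Phi> :: "(nat \<Rightarrow> real) \<Rightarrow> 'a set \<Rightarrow> real" where
  "\<Phi> g y = ((if x \<in> y then v0 g else 0) + (2 ^ card X - real (card y)) * R g) / 2 ^ card X"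

definition pick_avg :: "(nat \<Rightarrow> real) \<Rightarrow> 'a set \<Rightarrow> nat \<Rightarrow> real" where
  "pick_avg g y i = (\<Sum>Z<2 ^ i. V g (Pick y Z i) (length w)) / 2 ^ i"

lemma pick_avg_end:
  assumes y: "y \<subseteq> X" shows "pick_avg g y (card X) = \<Phi> g y"
proof -
  let ?l = "card X" and ?f = "from_nat_into X"
  let ?hit = "{Z. Z < ?l \<and> ?f Z \<in> y}"
  have bij: "bij_betw ?f {..<?l} X" by (rule bij_betw_from_nat_into_finite[OF finX])
  have "?f ` ?hit = y"
  proof
    show "y \<subseteq> ?f ` ?hit"
    proof
      fix a assume "a \<in> y"
      moreover from this y have "a \<in> ?f ` {..<?l}" using bij by (auto simp: bij_betw_def)
      ultimately show "a \<in> ?f ` ?hit" by auto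
    qed
  qed auto
  moreover have inj: "inj_on ?f ?hit"
    using bij by (auto simp: bij_betw_def intro: inj_on_subset)
  ultimately have hit: "bij_betw ?f ?hit y" by (simp add: bij_betw_def)
  have sub: "?hit \<subseteq> {..<2 ^ ?l}" by (auto intro: less_trans[OF _ less_exp])
  have V: "V g (Pick y Z ?l) (length w) = (if Z \<in> ?hit then (if ?f Z = x then v0 g else 0) else R g)"
    if Z: "Z < 2 ^ ?l" for Z
  proof (cases "Z \<in> ?hit")
    case True
    then have "act sampler (code (Pick y Z ?l)) (scan (input_tape X (p 0)) (length w)) = Halt (?f Z) []"
      using act_sampler(11)[OF y _ Z] by simp
    from val_Halt[where p = p, OF this] True show ?thesis by (simp add: V_def v0_def)
  next
    case False
    then have "act sampler (code (Pick y Z ?l)) (scan w (length w)) = Move_Right (code Start)"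
      using act_sampler(11)[OF y _ Z] by auto
    from V_Right_move[OF this, of g] show ?thesis unfolding if_not_P[OF False] by (simp add: V_Start)
  qed
  have "(\<Sum>Z<2 ^ ?l. V g (Pick y Z ?l) (length w)) =
      (\<Sum>Z<2 ^ ?l. if Z \<in> ?hit then (if ?f Z = x then v0 g else 0) else R g)"
    by (rule sum.cong) (auto simp: V)
  also have "\<dots> = (\<Sum>Z\<in>?hit. if ?f Z = x then v0 g else 0) + (\<Sum>Z\<in>{..<2 ^ ?l} - ?hit. R g)"
    using sub by (subst sum.If_cases) (auto simp: Int_absorb1 Diff_eq)
  also have "(\<Sum>Z\<in>?hit. if ?f Z = x then v0 g else 0) = (\<Sum>a\<in>y. if a = x then v0 g else 0)"
    by (rule sum.reindex_bij_betw[OF hit])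
  also have "\<dots> = (if x \<in> y then v0 g else 0)"
    using finite_subset[OF y finX] by simp
  also have "(\<Sum>Z\<in>{..<2 ^ ?l} - ?hit. R g) = (2 ^ ?l - real (card y)) * R g"
  proof -
    have c: "card ?hit = card y" by (rule bij_betw_same_card[OF hit])
    have "card ?hit \<le> 2 ^ ?l" using card_mono[OF _ sub] by simp
    then show ?thesis using sub c by (simp add: card_Diff_subset of_nat_diff)
  qed
  finally show ?thesis by (simp add: pick_avg_def \<Phi>_def)
qed

lemma pick_avg_Suc:
  assumes y: "y \<subseteq> X" and i: "i < card X"
  shows "pick_avg one y i = pick_avg one y (Suc i)"
    and "pick_avg (capped K) y i \<le> pick_avg one y i + pick_avg (capped K) y (Suc i)"
proof -
  let ?L = "length w"
  have dbl: "(\<Sum>Z<2 ^ Suc i. f Z) = (\<Sum>Z<2 ^ i. f (2 * Z + 1) + f (2 * Z) :: real)" for f :: "nat \<Rightarrow> real"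
  proof -
    have "(\<Sum>Z<2 * M. f Z) = (\<Sum>Z<M. f (2 * Z + 1) + f (2 * Z))" for M :: nat
      by (induction M) (simp_all add: algebra_simps)
    then show ?thesis by simp
  qed
  have toss: "act sampler (code (Pick y Z i)) (scan w ?L) =
      Toss (\<lambda>b. code (Pick y (2 * Z + of_bool b) (Suc i)))" if "Z < 2 ^ i" for Z
    using act_sampler(11)[OF y _ that] i by simp
  have "(\<Sum>Z<2 ^ i. V one (Pick y Z i) ?L) =
      (\<Sum>Z<2 ^ i. (V one (Pick y (2 * Z + 1) (Suc i)) ?L + V one (Pick y (2 * Z) (Suc i)) ?L) / 2)"
    by (rule sum.cong) (use V_Toss(1)[OF toss] in auto)
  also have "\<dots> = (\<Sum>Z<2 ^ Suc i. V one (Pick y Z (Suc i)) ?L) / 2"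
    unfolding dbl by (simp add: sum_divide_distrib)
  finally show "pick_avg one y i = pick_avg one y (Suc i)" by (simp add: pick_avg_def field_simps)
  have "(\<Sum>Z<2 ^ i. V (capped K) (Pick y Z i) ?L) \<le>
      (\<Sum>Z<2 ^ i. V one (Pick y Z i) ?L +
        (V (capped K) (Pick y (2 * Z + 1) (Suc i)) ?L + V (capped K) (Pick y (2 * Z) (Suc i)) ?L) / 2)"
    by (rule sum_mono) (use V_Toss(2)[OF toss] in auto)
  also have "\<dots> = (\<Sum>Z<2 ^ i. V one (Pick y Z i) ?L) + (\<Sum>Z<2 ^ Suc i. V (capped K) (Pick y Z (Suc i)) ?L) / 2"
    unfolding dbl by (simp add: sum.distrib sum_divide_distrib[symmetric])
  finally have "(\<Sum>Z<2 ^ i. V (capped K) (Pick y Z i) ?L) / 2 ^ i \<le>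
      ((\<Sum>Z<2 ^ i. V one (Pick y Z i) ?L) + (\<Sum>Z<2 ^ Suc i. V (capped K) (Pick y Z (Suc i)) ?L) / 2) / 2 ^ i"
    by (rule divide_right_mono) simp
  then show "pick_avg (capped K) y i \<le> pick_avg one y i + pick_avg (capped K) y (Suc i)"
    by (simp add: pick_avg_def add_divide_distrib)
qed

lemma V_Right_end:
  assumes y: "y \<subseteq> X"
  shows "V one (March_Right y) (length w) = \<Phi> one y"
    and "V (capped K) (March_Right y) (length w) \<le> real (card X) * \<Phi> one y + \<Phi> (capped K) y"
proof -
  have start: "V g (March_Right y) (length w) = pick_avg g y 0" for g
    using V_Right_move[of "March_Right y" "length w" "Pick y 0 0" g] act_sampler(6)[OF y]
    by (simp add: pick_avg_def)
  have "pick_avg one y (card X - j) = \<Phi> one y \<and>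
      pick_avg (capped K) y (card X - j) \<le> real j * \<Phi> one y + \<Phi> (capped K) y" if "j \<le> card X" for j
    using that
  proof (induction j)
    case 0
    then show ?case using pick_avg_end[OF y] by simp
  next
    case (Suc j)
    then have "Suc (card X - Suc j) = card X - j" by simp
    then show ?case
      using Suc pick_avg_Suc(1)[OF y, of "card X - Suc j"] pick_avg_Suc(2)[OF y, of "card X - Suc j" K]
      by (simp add: algebra_simps)
  qed
  from this[of "card X"] show "V one (March_Right y) (length w) = \<Phi> one y"
    "V (capped K) (March_Right y) (length w) \<le> real (card X) * \<Phi> one y + \<Phi> (capped K) y"
    by (simp_all add: start)
qed

lemma V_Right_step:
  assumes y: "y \<subseteq> X" and h: "h < length w"
  shows "V one (March_Right y) h = 3/4 * V one (March_Right y) (Suc h) + 1/4 * V one (March_Right (w ! h)) (Suc h)"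
    and "V (capped K) (March_Right y) h \<le> 2 * V one (March_Right y) h +
      (3/4 * V (capped K) (March_Right y) (Suc h) + 1/4 * V (capped K) (March_Right (w ! h)) (Suc h))"
proof -
  note c = cell_Pow[OF h]
  have go: "V g (Go_Right z) h = V g (March_Right z) (Suc h)" if "z \<subseteq> X" for g z
    using V_Right_move[of "Go_Right z" h "March_Right z" g] act_sampler(10)[OF that] h by (simp add: min_def)
  have t1: "act sampler (code (March_Right y)) (scan w h) = Toss (\<lambda>b. code (if b then Go_Right y else March_Right2 y))"
    using act_sampler(7)[OF y] h by simp
  have t2: "act sampler (code (March_Right2 y)) (scan w h) = Toss (\<lambda>b. code (Go_Right (if b then y else w ! h)))"
    using act_sampler(8)[OF y, of "w ! h", unfolded c(2)] h by simp
  note e = V_Toss[OF t1] V_Toss[OF t2]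
  show "V one (March_Right y) h = 3/4 * V one (March_Right y) (Suc h) + 1/4 * V one (March_Right (w ! h)) (Suc h)"
    using e(1,3) by (simp add: go y c) argo
  show "V (capped K) (March_Right y) h \<le> 2 * V one (March_Right y) h +
      (3/4 * V (capped K) (March_Right y) (Suc h) + 1/4 * V (capped K) (March_Right (w ! h)) (Suc h))"
    using e(1) e(2)[of K] e(4)[of K] V_nonneg[OF bounded_reward_one, of "March_Right y" "Suc h"]
    by (simp add: go y c) argo
qed

lemma V_Right:
  assumes "h \<le> length w" "y \<subseteq> X"
  shows "V one (March_Right y) h = right_march w (\<Phi> one) h y"
    and "V (capped K) (March_Right y) h \<le>
      (2 * (real (length w) - real h) + real (card X)) * V one (March_Right y) h + right_march w (\<Phi> (capped K)) h y"
proof -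
  have "\<forall>y\<subseteq>X. V one (March_Right y) h = right_march w (\<Phi> one) h y \<and> V (capped K) (March_Right y) h \<le>
      (2 * (real (length w) - real h) + real (card X)) * V one (March_Right y) h + right_march w (\<Phi> (capped K)) h y"
    using assms(1)
  proof (induction h rule: inc_induct)
    case base
    then show ?case using V_Right_end by simp
  next
    case (step h)
    note c = cell_Pow[OF step.hyps(2)]
    have affine: "s + (3/4 * (a * u + r) + 1/4 * (a * u' + r')) =
        s + a * (3/4 * u + 1/4 * u') + (3/4 * r + 1/4 * r')" for a s u u' r r' :: real
      by (simp add: field_simps)
    show ?case
    proof (intro allI impI conjI)
      fix y assume y: "y \<subseteq> X"
      note s = V_Right_step[OF y step.hyps(2)]
      show "V one (March_Right y) h = right_march w (\<Phi> one) h y"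
        using s(1) right_march_step[OF step.hyps(2), of "\<Phi> one" y] step.IH y c by simp
      let ?a = "2 * (real (length w) - real (Suc h)) + real (card X)"
      have "V (capped K) (March_Right y) h \<le> 2 * V one (March_Right y) h +
        (3/4 * (?a * V one (March_Right y) (Suc h) + right_march w (\<Phi> (capped K)) (Suc h) y) +
         1/4 * (?a * V one (March_Right (w ! h)) (Suc h) + right_march w (\<Phi> (capped K)) (Suc h) (w ! h)))"
      proof -
        note i = step.IH[rule_format, OF y, THEN conjunct2] step.IH[rule_format, OF c(1), THEN conjunct2]
        show ?thesis
          by (rule order.trans[OF s(2)[of K]])
            (rule add_left_mono, rule add_mono; rule mult_left_mono, rule i, simp)
      qed
      also have "\<dots> = 2 * V one (March_Right y) h +
          ?a * (3/4 * V one (March_Right y) (Suc h) + 1/4 * V one (March_Right (w ! h)) (Suc h)) +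
          (3/4 * right_march w (\<Phi> (capped K)) (Suc h) y + 1/4 * right_march w (\<Phi> (capped K)) (Suc h) (w ! h))"
        by (rule affine)
      also have "\<dots> = 2 * V one (March_Right y) h + ?a * V one (March_Right y) h + right_march w (\<Phi> (capped K)) h y"
        by (simp only: s(1)[symmetric] right_march_step[OF step.hyps(2), symmetric])
      finally show "V (capped K) (March_Right y) h \<le> (2 * (real (length w) - real h) + real (card X)) *
          V one (March_Right y) h + right_march w (\<Phi> (capped K)) h y"
        by (simp add: algebra_simps)
    qed
  qed
  then show "V one (March_Right y) h = right_march w (\<Phi> one) h y"
    "V (capped K) (March_Right y) h \<le>
      (2 * (real (length w) - real h) + real (card X)) * V one (March_Right y) h + right_march w (\<Phi> (capped K)) h y"
    using assms(2) by auto
qed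

lemma V_Left_step:
  shows "V one March_Left h = 2/3 * V one March_Left (h - 1) + 1/3 * V one (March_Right {}) h"
    and "V (capped K) March_Left h \<le> 8/3 * V one March_Left h +
      2/3 * V (capped K) March_Left (h - 1) + 1/3 * V (capped K) (March_Right {}) h"
proof -
  have go: "V g Go_Left h = V g March_Left (h - 1)" for g
    by (rule V_Left_move) (rule act_sampler(5))
  note e = V_Toss[OF act_sampler(3), where h = h] V_Toss[OF act_sampler(4), where h = h]
  show "V one March_Left h = 2/3 * V one March_Left (h - 1) + 1/3 * V one (March_Right {}) h"
    using e(1,3) by (simp add: go) argo
  show "V (capped K) March_Left h \<le> 8/3 * V one March_Left h +
      2/3 * V (capped K) March_Left (h - 1) + 1/3 * V (capped K) (March_Right {}) h"
    using e(1) e(2)[of K] e(4)[of K] V_nonneg[OF bounded_reward_one, of March_Left "h - 1"]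
    by (simp add: go) argo
qed

lemma V_Left:
  assumes "h < length w"
  shows "V one March_Left h = left_march w (\<Phi> one) h"
    and "V (capped K) March_Left h \<le>
      (8 + 3 * real h + 2 * real (length w) + real (card X)) * V one March_Left h + left_march w (\<Phi> (capped K)) h"
  using assms
proof (induction h)
  case 0
  case 1
  show ?case using V_Left_step(1)[of 0] V_Right(1)[of 0 "{}"] by (simp add: left_march_0)
next
  case 0
  case 2
  have "V one March_Left 0 = V one (March_Right {}) 0" using V_Left_step(1)[of 0] by simp
  then show ?case
    using V_Left_step(2)[of K 0] V_Right(2)[of 0 "{}" K] by (simp add: left_march_0 algebra_simps)
next
  case (Suc h)
  case 1
  then show ?case
    using Suc V_Left_step(1)[of "Suc h"] V_Right(1)[of "Suc h" "{}"] left_march_step[of h w] by simp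
next
  case (Suc h)
  case 2
  let ?b = "8 + 3 * real h + 2 * real (length w) + real (card X)"
  have affine: "s + 2/3 * (a * u + r) + 1/3 * (a * u' + r') =
      s + a * (2/3 * u + 1/3 * u') + (2/3 * r + 1/3 * r')" for a s u u' r r' :: real
    by (simp add: field_simps)
  have "V (capped K) (March_Right {}) (Suc h) \<le> ?b * V one (March_Right {}) (Suc h) + right_march w (\<Phi> (capped K)) (Suc h) {}"
  proof -
    have "(2 * (real (length w) - real (Suc h)) + real (card X)) * V one (March_Right {}) (Suc h)
        \<le> ?b * V one (March_Right {}) (Suc h)"
      by (intro mult_right_mono V_nonneg bounded_reward_one) auto
    then show ?thesis using V_Right(2)[of "Suc h" "{}" K] 2 by simp
  qed
  moreover have "V (capped K) March_Left h \<le> ?b * V one March_Left h + left_march w (\<Phi> (capped K)) h"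
    using Suc 2 by simp
  ultimately have "V (capped K) March_Left (Suc h) \<le> 8/3 * V one March_Left (Suc h) +
      2/3 * (?b * V one March_Left h + left_march w (\<Phi> (capped K)) h) +
      1/3 * (?b * V one (March_Right {}) (Suc h) + right_march w (\<Phi> (capped K)) (Suc h) {})"
    by (intro order.trans[OF V_Left_step(2)[of K "Suc h"]] add_mono order_refl mult_left_mono) simp_all
  also have "\<dots> = 8/3 * V one March_Left (Suc h) +
      ?b * (2/3 * V one March_Left h + 1/3 * V one (March_Right {}) (Suc h)) +
      (2/3 * left_march w (\<Phi> (capped K)) h + 1/3 * right_march w (\<Phi> (capped K)) (Suc h) {})"
    by (rule affine)
  also have "2/3 * left_march w (\<Phi> (capped K)) h + 1/3 * right_march w (\<Phi> (capped K)) (Suc h) {} =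
      left_march w (\<Phi> (capped K)) (Suc h)"
    using left_march_step[of h w "\<Phi> (capped K)"] 2 by simp
  also have "2/3 * V one March_Left h + 1/3 * V one (March_Right {}) (Suc h) = V one March_Left (Suc h)"
    using V_Left_step(1)[of "Suc h"] by simp
  also have "8/3 * V one March_Left (Suc h) + ?b * V one March_Left (Suc h) \<le>
      (8 + 3 * real (Suc h) + 2 * real (length w) + real (card X)) * V one March_Left (Suc h)"
    using V_nonneg[OF bounded_reward_one, of March_Left "Suc h"] by (simp add: algebra_simps)
  finally show ?case by simp
qed

lemma left_march_last_eq:
  "left_march w (\<Phi> g) (length w - 1) = R g +
     (real (wt w x) * v0 g - real k * R g) / (2 ^ card X * 2 ^ Suc (length w))"
proof -
  have diff: "\<Phi> g y - \<Phi> g {} = ((if x \<in> y then v0 g else 0) - real (card y) * R g) / 2 ^ card X" for y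
    by (simp add: \<Phi>_def field_simps)
  have "(\<Sum>m<length w. 2 ^ m * ((if x \<in> w ! m then v0 g else 0) - real (card (w ! m)) * R g)) =
      (\<Sum>m<length w. (if x \<in> w ! m then 2 ^ m else 0) * v0 g) -
      (\<Sum>m<length w. 2 ^ m * real (card (w ! m)) * R g)"
    unfolding sum_subtractf[symmetric] by (rule sum.cong) (auto simp: algebra_simps)
  also have "(\<Sum>m<length w. (if x \<in> w ! m then 2 ^ m else 0) * v0 g) = real (wt w x) * v0 g"
  proof -
    have "real (wt w x) = (\<Sum>m<length w. if x \<in> w ! m then 2 ^ m else 0)"
      unfolding wt_def of_nat_sum by (rule sum.cong) auto
    then show ?thesis by (simp add: sum_distrib_right)
  qed
  also have "(\<Sum>m<length w. 2 ^ m * real (card (w ! m)) * R g) = real k * R g"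
  proof -
    have "real k = (\<Sum>a\<in>X. \<Sum>m<length w. if a \<in> w ! m then 2 ^ m else 0)"
      unfolding k_def tape_total_def wt_def of_nat_sum by (intro sum.cong) auto
    also have "\<dots> = (\<Sum>m<length w. \<Sum>a\<in>X. if a \<in> w ! m then 2 ^ m else 0)"
      by (rule sum.swap)
    also have "\<dots> = (\<Sum>m<length w. 2 ^ m * real (card (w ! m)))"
    proof (rule sum.cong[OF refl])
      fix m assume "m \<in> {..<length w}"
      then have "X \<inter> {a. a \<in> w ! m} = w ! m" using cell_Pow(2)[of m] by auto
      then show "(\<Sum>a\<in>X. if a \<in> w ! m then 2 ^ m else 0) = (2 ^ m * real (card (w ! m)) :: real)"
        using finX by (simp add: sum.If_cases)
    qed
    finally show ?thesis by (simp add: sum_distrib_right)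
  qed
  finally have s: "(\<Sum>m<length w. 2 ^ m * ((if x \<in> w ! m then v0 g else 0) - real (card (w ! m)) * R g)) =
      real (wt w x) * v0 g - real k * R g" .
  have "(\<Sum>m<length w. 2 ^ m * (\<Phi> g (w ! m) - \<Phi> g {})) =
      (real (wt w x) * v0 g - real k * R g) / 2 ^ card X"
    unfolding diff s[symmetric] sum_divide_distrib by (rule sum.cong) auto
  then show ?thesis
    unfolding left_march_last[OF w_pos] by (simp add: \<Phi>_def)
qed

lemma R_prob: "R one = of_rat (p 0 x) * v0 one"
proof -
  have "R one = left_march w (\<Phi> one) (length w - 1)"
    unfolding R_def using w_pos by (intro V_Left(1)) simp
  then have "real (wt w x) * v0 one - real k * R one = 0"
    unfolding left_march_last_eq by simp
  then show ?thesis using k_pos by (simp add: p_wt field_simps)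
qed

lemma R_cost:
  "R (capped K) \<le> of_rat (p 0 x) * v0 (capped K) +
     2 ^ (card X + 2) * (8 + 5 * real (length w) + real (card X)) * R one"
proof -
  let ?b = "8 + 5 * real (length w) + real (card X)" and ?T = "2 ^ card X * 2 ^ Suc (length w) :: real"
  have R0: "0 \<le> R one" unfolding R_def by (rule V_nonneg[OF bounded_reward_one])
  have "R (capped K) \<le> (8 + 3 * real (length w - 1) + 2 * real (length w) + real (card X)) * R one +
      left_march w (\<Phi> (capped K)) (length w - 1)"
    unfolding R_def using w_pos by (intro V_Left(2)) simp
  also have "\<dots> \<le> ?b * R one + left_march w (\<Phi> (capped K)) (length w - 1)"
    using R0 by (intro add_right_mono mult_right_mono) auto
  finally have "(real k * R (capped K) - real (wt w x) * v0 (capped K)) / ?T \<le> ?b * R one"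
    unfolding left_march_last_eq by (simp add: diff_divide_distrib)
  then have "real k * R (capped K) - real (wt w x) * v0 (capped K) \<le> ?b * R one * ?T"
    by (subst (asm) divide_le_eq) auto
  also have "\<dots> \<le> ?b * R one * (real k * 2 ^ (card X + 2))"
  proof (intro mult_left_mono)
    have "2 ^ Suc (length w) = (4 * 2 ^ (length w - 1) :: nat)"
      using w_pos by (cases "length w") auto
    also have "\<dots> \<le> 4 * k" using k_ge by simp
    finally have "real (2 ^ Suc (length w)) \<le> real (4 * k)" by (simp only: of_nat_le_iff)
    then have "2 ^ card X * 2 ^ Suc (length w) \<le> 2 ^ card X * real (4 * k)"
      by (intro mult_left_mono) auto
    then show "?T \<le> real k * 2 ^ (card X + 2)" by (simp add: power_add mult_ac)
  qed (use R0 in auto)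
  finally have "real k * R (capped K) \<le>
      real k * (real (wt w x) / real k * v0 (capped K) + 2 ^ (card X + 2) * ?b * R one)"
    using k_pos by (simp add: algebra_simps)
  then show ?thesis using k_pos by (simp add: p_wt)
qed

end

context small_sampler
begin

lemma value0_prob:
  assumes "\<And>i. p i \<in> rat_dists X" "set xs \<subseteq> X"
  shows "value0 sampler X (\<lambda>_. 1) p xs [] = (\<Prod>i<length xs. of_rat (p i (xs ! i)))"
  using assms
proof (induction xs arbitrary: p)
  case (Cons x xs)
  interpret small_round X p x xs "input_tape X (p 0)" "tape_total X (input_tape X (p 0))"
    using Cons.prems by unfold_locales auto
  have "v0 one = (\<Prod>i<length xs. of_rat (p (Suc i) (xs ! i)))"
    unfolding v0_def one_def using Cons.prems by (intro Cons.IH) auto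
  then show ?case
    unfolding length_Cons prod.lessThan_Suc_shift value0_eq_R
    using R_prob by (simp add: one_def)
qed simp

lemma act_phases:
  assumes "q \<in> phases"
  shows "case act sampler (code q) c of
      Toss f \<Rightarrow> \<forall>b. f b \<in> code ` phases
    | Move_Left m \<Rightarrow> m \<in> code ` phases
    | Move_Right m \<Rightarrow> m \<in> code ` phases
    | Halt a s \<Rightarrow> s = []"
proof (cases q)
  case (Pick y Z i)
  then have b: "y \<subseteq> X" "i \<le> card X" "Z < 2 ^ i" using assms by (auto simp: phases_def)
  have "Pick y (2 * Z + of_bool b') (Suc i) \<in> phases" if "i < card X" for b'
    using b that by (intro Pick_phase) (auto simp: of_bool_def)
  then show ?thesis
    using Pick phases_intros(1) by (auto simp: act_sampler(11)[OF b] simp del: code_Start) simp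
next
  case (March_Right y)
  then have y: "y \<subseteq> X" using assms by (auto simp: phases_def)
  show ?thesis
    using March_Right phases_intros(6,7)[OF y] Pick_phase[OF y, of 0 0]
    by (cases c) (auto simp: act_sampler(6,7)[OF y])
next
  case (March_Right2 y)
  then have y: "y \<subseteq> X" using assms by (auto simp: phases_def)
  have "Go_Right (a \<inter> X) \<in> phases" for a by (rule phases_intros) simp
  then show ?thesis
    using March_Right2 phases_intros(1) phases_intros(7)[OF y]
    by (cases c) (auto simp: act_sampler(8,9)[OF y] simp del: code_Start)
next
  case (Go_Right y)
  then have y: "y \<subseteq> X" using assms by (auto simp: phases_def)
  show ?thesis using Go_Right phases_intros(5)[OF y] by (simp add: act_sampler(10)[OF y])
qed (cases c, use phases_intros in \<open>auto simp: act_sampler(1-5) simp del: code_Start\<close>)+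

lemma online: "online_sampler X sampler"
  by (rule online_samplerI[OF finX]) (simp add: value0_prob)

lemma value0_cost:
  assumes "\<And>i. p i \<in> rat_dists X" "set xs \<subseteq> X" "\<And>i. real (length (input_tape X (p i))) \<le> L"
  shows "value0 sampler X (capped K) p xs [] \<le> (\<Prod>i<length xs. of_rat (p i (xs ! i))) *
    (2 ^ (card X + 2) * (8 + 5 * L + real (card X)) * real (length xs))"
  using assms
proof (induction xs arbitrary: p)
  case Nil
  then show ?case by (simp add: capped_def)
next
  case (Cons x xs)
  interpret small_round X p x xs "input_tape X (p 0)" "tape_total X (input_tape X (p 0))"
    using Cons.prems by unfold_locales auto
  let ?A = "2 ^ (card X + 2) * (8 + 5 * L + real (card X))"
  define px :: real where "px = of_rat (p 0 x)"
  define P' :: real where "P' = (\<Prod>i<length xs. of_rat (p (Suc i) (xs ! i)))"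
  have px: "0 \<le> px" using p0 x by (auto simp: px_def rat_dists_def)
  have v: "v0 (capped K) \<le> P' * (?A * real (length xs))"
    unfolding v0_def P'_def using Cons.prems by (intro Cons.IH) auto
  have v1: "v0 one = P'"
    unfolding v0_def P'_def one_def using Cons.prems by (intro value0_prob) auto
  have R1: "R one = px * P'" using R_prob by (simp add: px_def v1)
  have R0: "0 \<le> R one" unfolding R_def by (rule V_nonneg[OF bounded_reward_one])
  have "R (capped K) \<le> px * v0 (capped K) +
      2 ^ (card X + 2) * (8 + 5 * real (length (input_tape X (p 0))) + real (card X)) * R one"
    using R_cost[of K] by (simp add: px_def)
  also have "\<dots> \<le> px * (P' * (?A * real (length xs))) + ?A * R one"
    using v px R0 Cons.prems(3)[of 0] by (intro add_mono mult_left_mono mult_right_mono) auto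
  also have "\<dots> = px * P' * (?A * real (length (x # xs)))"
    unfolding R1 by (simp add: algebra_simps)
  finally show ?case
    unfolding length_Cons prod.lessThan_Suc_shift value0_eq_R by (simp add: px_def P'_def)
qed

lemma
  assumes run: "run sampler X p B n = Some (xs, s, t)"
  shows run_state: "s = []"
    and steps_phase: "\<exists>q\<in>phases. fst ((step sampler (input_tape X (p n)) B ^^ j) (s, 0, t)) = code q"
proof -
  let ?R = "\<lambda>n :: nat. {(m, h :: nat). m \<in> code ` phases}"
  have init: "init_state sampler \<in> {[]}" by simp
  have start: "(s, 0) \<in> ?R n" if "s \<in> {[]}" for s n
    using that phases_intros(1) code_Start by force
  have step: "(m', h') \<in> ?R n"
    if "(m, h) \<in> ?R n" "step sampler (input_tape X (p n)) B (m, h, t) = (m', h', t')" for n m h t B m' h' t'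
  proof -
    from that(1) obtain q where q: "q \<in> phases" "m = code q" by auto
    from act_phases[OF q(1), of "scan (input_tape X (p n)) h"] that(2) q
    show ?thesis by (auto split: action.splits)
  qed
  have halt: "s \<in> {[]}"
    if "(m, h) \<in> ?R n" "act sampler m (scan (input_tape X (p n)) h) = Halt x s" for n m h x s
  proof -
    from that(1) obtain q where q: "q \<in> phases" "m = code q" by auto
    from act_phases[OF q(1), of "scan (input_tape X (p n)) h"] that(2) q show ?thesis by auto
  qed
  have "s \<in> {[]}"
    by (rule run_invariant(1)[where R = ?R, OF init start step halt run])
  then show "s = []" by simp
  have "\<exists>h. (fst ((step sampler (input_tape X (p n)) B ^^ j) (s, 0, t)), h) \<in> ?R n"
    by (rule run_invariant(2)[where R = ?R, OF init start step halt run])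
  then show "\<exists>q\<in>phases. fst ((step sampler (input_tape X (p n)) B ^^ j) (s, 0, t)) = code q"
    by auto
qed

lemma carried_space: "0 \<le> b \<Longrightarrow> carried_space_le sampler X p b"
  using run_state by (fastforce simp: carried_space_le_def)

lemma temp_space: "real (card phases) \<le> b \<Longrightarrow> temp_space_le sampler X p b"
  unfolding temp_space_le_def
proof (intro allI impI)
  fix B n xs s t j
  assume b: "real (card phases) \<le> b" and "run sampler X p B n = Some (xs, s, t)"
  from steps_phase[OF this(2), of j] obtain q where
    q: "q \<in> phases" "fst ((step sampler (input_tape X (p n)) B ^^ j) (s, 0, t)) = code q" by blast
  then show "real (length (fst ((step sampler (input_tape X (p n)) B ^^ j) (s, 0, t)))) \<le> b"
    using length_code_le[OF q(1)] b by simp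
qed

end

section \<open>Choice of the sampler\<close>

lemma log2_le_self: "log 2 z \<le> z" if "0 < z" for z :: real
proof -
  have "ln z = ln (z / 2) + ln 2" using that by (simp add: ln_div)
  also have "ln (z / 2) \<le> z / 2 - 1" using that by (intro ln_le_minus_one) simp
  finally have "ln z \<le> z / 2" using ln_2_less_1 by simp
  also have "\<dots> \<le> z * ln 2"
    using mult_left_mono[of "1 / 2" "ln 2" z] ln2_ge_two_thirds that by simp
  finally show ?thesis by (simp add: log_def divide_le_eq)
qed

lemma log2_le_half: "log 2 z \<le> 1 + z / 2" if "0 < z" for z :: real
proof -
  have "log 2 z = 1 + log 2 (z / 2)" using that by (simp add: log_divide)
  then show ?thesis using log2_le_self[of "z / 2"] that by simp
qed

definition lg_scale :: "nat \<Rightarrow> real \<Rightarrow> real" where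
  "lg_scale d \<epsilon> = log 2 (real d * max 1 (1 / \<epsilon>))"

text \<open>With \<open>t = lg_scale d \<epsilon>\<close> and \<open>v = pool_bits d \<epsilon>\<close>, this choice gives
  \<open>2 ^ v \<ge> d / \<epsilon> * (t + 8)\<^sup>2 \<ge> d / \<epsilon> * (2 * v + 7)\<close>, so that the loss per round is at most \<open>\<epsilon>\<close>.\<close>

definition pool_bits :: "nat \<Rightarrow> real \<Rightarrow> nat" where
  "pool_bits d \<epsilon> = nat \<lceil>lg_scale d \<epsilon> + 2 * log 2 (lg_scale d \<epsilon> + 8)\<rceil>"

definition overhead :: "nat \<Rightarrow> real \<Rightarrow> real" where
  "overhead d \<epsilon> = (if \<epsilon> < 2 * log 2 (real d) + 4 then real (pool_bits d \<epsilon>) + 2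
     else max 1 (log 2 (real d / \<epsilon>)))"

lemma lg_scale_ge:
  assumes "1 \<le> d" "0 < \<epsilon>"
  shows "0 \<le> log 2 (real d)" "log 2 (real d) \<le> lg_scale d \<epsilon>" "log 2 (real d / \<epsilon>) \<le> lg_scale d \<epsilon>"
proof -
  show "0 \<le> log 2 (real d)" using assms by simp
  have "real d * 1 \<le> real d * max 1 (1 / \<epsilon>)" "real d * (1 / \<epsilon>) \<le> real d * max 1 (1 / \<epsilon>)"
    by (intro mult_left_mono; simp)+
  then show "log 2 (real d) \<le> lg_scale d \<epsilon>" "log 2 (real d / \<epsilon>) \<le> lg_scale d \<epsilon>"
    using assms unfolding lg_scale_def by (auto intro!: log_mono)
qed

lemma pool_bits_bounds:
  assumes "1 \<le> d" "0 < \<epsilon>"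
  shows "lg_scale d \<epsilon> + 2 * log 2 (lg_scale d \<epsilon> + 8) \<le> real (pool_bits d \<epsilon>)"
    and "real (pool_bits d \<epsilon>) \<le> lg_scale d \<epsilon> + 2 * log 2 (lg_scale d \<epsilon> + 8) + 1"
proof -
  let ?t = "lg_scale d \<epsilon>"
  have "0 \<le> ?t" using lg_scale_ge[OF assms] by linarith
  then have "0 \<le> ?t + 2 * log 2 (?t + 8)" by simp
  then show "?t + 2 * log 2 (?t + 8) \<le> real (pool_bits d \<epsilon>)"
    "real (pool_bits d \<epsilon>) \<le> ?t + 2 * log 2 (?t + 8) + 1"
    unfolding pool_bits_def by linarith+
qed

lemma pool_bits_large:
  assumes "1 \<le> d" "0 < \<epsilon>"
  shows "2 * d \<le> 2 ^ pool_bits d \<epsilon>"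
    and "real d / 2 ^ pool_bits d \<epsilon> * (2 * real (pool_bits d \<epsilon>) + 7) \<le> \<epsilon>"
proof -
  let ?t = "lg_scale d \<epsilon>" and ?v = "pool_bits d \<epsilon>" and ?y = "real d * max 1 (1 / \<epsilon>)"
  have t: "0 \<le> ?t" using lg_scale_ge[OF assms] by linarith
  note b = pool_bits_bounds[OF assms]
  have y: "0 < ?y" using assms by (simp add: max_def)
  have "?y * (?t + 8) ^ 2 = 2 powr (?t + 2 * log 2 (?t + 8))"
  proof -
    have "2 powr ?t = ?y" unfolding lg_scale_def using y by simp
    moreover have "2 powr (2 * log 2 (?t + 8)) = (?t + 8) ^ 2"
    proof -
      have "2 powr (2 * log 2 (?t + 8)) = (2 powr log 2 (?t + 8)) powr 2"
        by (simp only: powr_powr mult.commute)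
      also have "\<dots> = (?t + 8) ^ 2" using t by simp
      finally show ?thesis .
    qed
    ultimately show ?thesis by (simp add: powr_add)
  qed
  also have "\<dots> \<le> 2 powr real ?v" using b(1) by simp
  also have "\<dots> = 2 ^ ?v" by (simp add: powr_realpow)
  finally have big: "?y * (?t + 8) ^ 2 \<le> 2 ^ ?v" .
  have d: "real d \<le> ?y" using mult_left_mono[of 1 "max 1 (1 / \<epsilon>)" "real d"] by simp
  have d\<epsilon>: "real d / \<epsilon> \<le> ?y" using mult_left_mono[of "1 / \<epsilon>" "max 1 (1 / \<epsilon>)" "real d"] by simp
  have "2 \<le> (?t + 8) ^ 2" using power_mono[of 8 "?t + 8" 2] t by simp
  then have "real d * 2 \<le> ?y * (?t + 8) ^ 2" using d y by (intro mult_mono) auto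
  then have "real (2 * d) \<le> real (2 ^ ?v)" using big by simp
  then show "2 * d \<le> 2 ^ ?v" by (simp only: of_nat_le_iff)
  have "2 * real ?v + 7 \<le> (?t + 8) ^ 2"
  proof -
    have "2 * real ?v + 7 \<le> 6 * (?t + 8) - 7"
      using b(2) log2_le_self[of "?t + 8"] t by simp
    also have "\<dots> \<le> ?t * ?t + 16 * ?t + 64"
      using t zero_le_mult_iff[of ?t ?t] by (simp add: add_nonneg_nonneg)
    also have "\<dots> = (?t + 8) ^ 2" by (simp add: power2_eq_square algebra_simps)
    finally show ?thesis .
  qed
  then have "real d / \<epsilon> * (2 * real ?v + 7) \<le> ?y * (?t + 8) ^ 2"
    using d\<epsilon> y by (intro mult_mono) auto
  also note big
  finally show "real d / 2 ^ ?v * (2 * real ?v + 7) \<le> \<epsilon>"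
    using assms by (simp add: field_simps)
qed

lemma overhead_bounds:
  assumes d: "1 \<le> d" and \<epsilon>: "0 < \<epsilon>" and s: "1 \<le> log 2 (real d / \<epsilon>)"
  defines "s \<equiv> log 2 (real d / \<epsilon>)"
  shows "s \<le> overhead d \<epsilon>"
    and "overhead d \<epsilon> \<le> s + (log 2 (4 * s + 16) + 2 * log 2 (2 * s + 14) + 3)"
proof -
  have h: "0 \<le> log 2 (4 * s + 16)" "0 \<le> log 2 (2 * s + 14)" using assms(3) by (simp_all add: s_def)
  have "s \<le> overhead d \<epsilon> \<and> overhead d \<epsilon> \<le> s + (log 2 (4 * s + 16) + 2 * log 2 (2 * s + 14) + 3)"
  proof (cases "\<epsilon> < 2 * log 2 (real d) + 4")
    case True
    let ?t = "lg_scale d \<epsilon>"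
    note b = pool_bits_bounds[OF d \<epsilon>] lg_scale_ge[OF d \<epsilon>]
    have t: "0 \<le> ?t" using b by linarith
    have o: "overhead d \<epsilon> = real (pool_bits d \<epsilon>) + 2" using True by (simp add: overhead_def)
    have "?t \<le> s + log 2 (2 * ?t + 4)"
    proof (cases "\<epsilon> \<le> 1")
      case True
      then have "max 1 (1 / \<epsilon>) = 1 / \<epsilon>" using \<epsilon> by (simp add: max_def)
      then have "?t = s" by (simp add: lg_scale_def s_def)
      then show ?thesis using t by simp
    next
      case False
      then have "max 1 (1 / \<epsilon>) = 1" by (simp add: max_def)
      then have "?t = log 2 (real d)" by (simp add: lg_scale_def)
      moreover have "s = log 2 (real d) - log 2 \<epsilon>" using d \<epsilon> by (simp add: s_def log_divide)
      moreover have "log 2 \<epsilon> \<le> log 2 (2 * ?t + 4)"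
        using True \<epsilon> calculation(1) by (intro log_mono) auto
      ultimately show ?thesis by simp
    qed
    moreover have "log 2 (2 * ?t + 4) \<le> ?t / 2 + 3"
    proof -
      have "log 2 (2 * ?t + 4) = log 2 (2 * (?t + 2))" by (simp add: algebra_simps)
      also have "\<dots> = 1 + log 2 (?t + 2)" using t by (subst log_mult) auto
      finally show ?thesis using log2_le_half[of "?t + 2"] t by (simp add: add_divide_distrib)
    qed
    ultimately have ts: "?t \<le> 2 * s + 6" "?t \<le> s + log 2 (2 * ?t + 4)" by linarith+
    have "log 2 (2 * ?t + 4) \<le> log 2 (4 * s + 16)" "log 2 (?t + 8) \<le> log 2 (2 * s + 14)"
      using ts t by (intro log_mono; simp)+
    moreover have "0 \<le> log 2 (?t + 8)" using t by simp
    ultimately show ?thesis using b ts o unfolding s_def by linarith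
  next
    case False
    then have "overhead d \<epsilon> = s" using assms(3) by (simp add: overhead_def s_def)
    then show ?thesis using h by simp
  qed
  then show "s \<le> overhead d \<epsilon>"
    "overhead d \<epsilon> \<le> s + (log 2 (4 * s + 16) + 2 * log 2 (2 * s + 14) + 3)" by auto
qed

lemma overhead_asymp:
  "(\<lambda>(d, \<epsilon>). overhead d \<epsilon>)
     \<sim>[filtercomap (\<lambda>(d, \<epsilon>). real d / \<epsilon>) at_top] (\<lambda>(d, \<epsilon>). log 2 (real d / \<epsilon>))"
proof (rule asymp_equivI')
  let ?F = "filtercomap (\<lambda>(d :: nat, \<epsilon>). real d / \<epsilon>) at_top"
  let ?r = "\<lambda>(d :: nat, \<epsilon>). real d / \<epsilon>"
  define u :: "real \<Rightarrow> real" where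
    "u r = 1 + (log 2 (4 * log 2 r + 16) + 2 * log 2 (2 * log 2 r + 14) + 3) / log 2 r" for r
  have "(u \<longlongrightarrow> 1) at_top" unfolding u_def by real_asymp
  then have lim: "((\<lambda>x. u (?r x)) \<longlongrightarrow> 1) ?F"
    by (rule filterlim_compose) (rule filterlim_filtercomap)
  have ev: "eventually (\<lambda>x. 2 \<le> ?r x) ?F"
    using eventually_filtercomapI[OF eventually_ge_at_top[of "2 :: real"], of ?r] .
  have bounds: "1 \<le> (case x of (d, \<epsilon>) \<Rightarrow> overhead d \<epsilon>) / (case x of (d, \<epsilon>) \<Rightarrow> log 2 (real d / \<epsilon>)) \<and>
      (case x of (d, \<epsilon>) \<Rightarrow> overhead d \<epsilon>) / (case x of (d, \<epsilon>) \<Rightarrow> log 2 (real d / \<epsilon>)) \<le> u (?r x)"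
    if "2 \<le> ?r x" for x :: "nat \<times> real"
  proof -
    obtain d \<epsilon> where x: "x = (d, \<epsilon>)" by (cases x)
    have r: "2 \<le> real d / \<epsilon>" using that x by simp
    then have "0 < real d / \<epsilon>" by linarith
    then have d: "1 \<le> d" and \<epsilon>: "0 < \<epsilon>" by (auto simp: zero_less_divide_iff)
    have "log 2 2 \<le> log 2 (real d / \<epsilon>)" using r by (intro log_mono) auto
    then have s: "1 \<le> log 2 (real d / \<epsilon>)" by simp
    let ?s = "log 2 (real d / \<epsilon>)"
    let ?h = "log 2 (4 * ?s + 16) + 2 * log 2 (2 * ?s + 14) + 3"
    note b = overhead_bounds[OF d \<epsilon> s]
    have "overhead d \<epsilon> / ?s \<le> (?s + ?h) / ?s" using b(2) s by (intro divide_right_mono) auto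
    also have "\<dots> = u (real d / \<epsilon>)" using s by (simp only: add_divide_distrib u_def) simp
    finally show ?thesis using b(1) s by (simp add: x)
  qed
  show "((\<lambda>x. (case x of (d, \<epsilon>) \<Rightarrow> overhead d \<epsilon>) / (case x of (d, \<epsilon>) \<Rightarrow> log 2 (real d / \<epsilon>))) \<longlongrightarrow> 1) ?F"
    by (rule tendsto_sandwich[OF _ _ tendsto_const lim]; rule eventually_mono[OF ev])
      (use bounds in auto)
qed

lemma expected_cost_less:
  assumes X: "finite X" and on: "online_sampler X S" and p: "\<And>i. p i \<in> rat_dists X"
    and xs: "xs \<in> lists X" and pos: "0 < measure coins (output_event S X p xs)"
    and cost: "\<And>K. (\<And>i. i < length xs \<Longrightarrow> 0 < p i (xs ! i)) \<Longrightarrow>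
      0 \<le> (\<Sum>i<length xs. log 2 (1 / of_rat (p i (xs ! i)) :: real)) \<Longrightarrow>
      0 \<le> (\<Prod>i<length xs. of_rat (p i (xs ! i)) :: real) \<Longrightarrow>
      value0 S X (capped K) p xs (init_state S) \<le> (\<Prod>i<length xs. of_rat (p i (xs ! i))) *
        ((\<Sum>i<length xs. log 2 (1 / of_rat (p i (xs ! i)))) + c)"
    and c: "c < e" "0 < e"
  shows "(\<integral>\<^sup>+B. entropy_cost S X p (length xs) B \<partial>uniform_measure coins (output_event S X p xs))
    < ennreal ((\<Sum>i<length xs. log 2 (1 / of_rat (p i (xs ! i)))) + e)"
proof -
  let ?S = "\<Sum>i<length xs. log 2 (1 / of_rat (p i (xs ! i)) :: real)"
  have m: "measure coins (output_event S X p xs) = (\<Prod>i<length xs. of_rat (p i (xs ! i)))"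
    using on p xs unfolding online_sampler_def by blast
  have 01: "0 \<le> p i (xs ! i) \<and> p i (xs ! i) \<le> 1" if "i < length xs" for i
  proof -
    have "xs ! i \<in> X" using xs that by auto
    then show ?thesis using p[of i] by (auto simp: rat_dists_def)
  qed
  have pp: "0 < p i (xs ! i)" if "i < length xs" for i
  proof -
    have "(\<Prod>i<length xs. of_rat (p i (xs ! i)) :: real) \<noteq> 0" using pos m by (metis less_irrefl)
    then have "p i (xs ! i) \<noteq> 0" using that by (auto simp: prod_zero_iff)
    then show ?thesis using 01[OF that] by simp
  qed
  have S: "0 \<le> ?S"
  proof (rule sum_nonneg)
    fix i assume "i \<in> {..<length xs}"
    then have "0 < (of_rat (p i (xs ! i)) :: real)" "(of_rat (p i (xs ! i)) :: real) \<le> 1"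
      using pp 01 by auto
    then show "0 \<le> log 2 (1 / of_rat (p i (xs ! i)) :: real)" by simp
  qed
  have "(\<integral>\<^sup>+B. entropy_cost S X p (length xs) B \<partial>uniform_measure coins (output_event S X p xs))
      \<le> ennreal (?S + c)"
    by (rule nn_integral_entropy_cost_le[OF pos]) (use cost[OF pp S] pos m in simp)
  also have "\<dots> < ennreal (?S + e)" using S c by (intro ennreal_lessI) auto
  finally show ?thesis .
qed

lemma sampler_exists:
  fixes X :: "'a set"
  assumes X: "finite X"
  shows "\<exists>C :: real. \<forall>d \<ge> 1. \<forall>\<epsilon> > 0. \<exists>S :: 'a sampler.
    online_sampler X S \<and>
    (\<forall>p. (\<forall>i. p i \<in> rat_dists_upto X d) \<longrightarrow>
       (\<forall>xs \<in> lists X. length xs \<ge> 1 \<and> measure coins (output_event S X p xs) > 0 \<longrightarrow>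
          (\<integral>\<^sup>+B. entropy_cost S X p (length xs) B \<partial>uniform_measure coins (output_event S X p xs))
            < ennreal ((\<Sum>i<length xs. log 2 (1 / of_rat (p i (xs ! i))))
                + \<epsilon> * real (length xs) + overhead d \<epsilon>)) \<and>
       carried_space_le S X p (2 * overhead d \<epsilon>) \<and>
       temp_space_le S X p (C * overhead d \<epsilon>))"
proof -
  interpret small: small_sampler X using X by unfold_locales
  let ?l = "real (card X)"
  define a where "a = 4 + 2 * real (Suc (card X))"
  define D where "D = 2 ^ (card X + 2) * (13 + ?l)"
  define C where "C = real (card small.phases) + a * (9 + 2 * log 2 D)"
  have a: "0 \<le> a" by (simp add: a_def)
  have D: "1 \<le> D" unfolding D_def using mult_mono[OF one_le_power[of 2 "card X + 2"], of 1 "13 + ?l"] by simp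
  then have lD: "0 \<le> log 2 D" by simp
  have Ca: "a * (9 + 2 * log 2 D) \<le> C" "real (card small.phases) \<le> C"
    using a lD by (auto simp: C_def)
  have C0: "0 \<le> C" using Ca(2) by linarith
  show ?thesis
  proof (rule exI[of _ C], intro allI impI, goal_cases)
    case (1 d \<epsilon>)
    then have d: "1 \<le> d" and \<epsilon>: "0 < \<epsilon>" by auto
    have log_d: "0 \<le> log 2 (real d)" using d by simp
    have dists: "\<And>i. p i \<in> rat_dists X" if "\<forall>i. p i \<in> rat_dists_upto X d" for p :: "nat \<Rightarrow> 'a \<Rightarrow> rat"
      using that by (simp add: rat_dists_upto_def)
    have temp_le: "4 * real v + 8 + 2 * (real (Suc (card X)) * (log 2 (real d) + 1)) \<le> a * z"
      if "real v + 2 \<le> z" "log 2 (real d) + 1 \<le> z" for v z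
    proof -
      have "2 * real (Suc (card X)) * (log 2 (real d) + 1) \<le> 2 * real (Suc (card X)) * z"
        using that by (intro mult_left_mono) auto
      then show ?thesis using that unfolding a_def by (simp add: distrib_right)
    qed
    show ?case
    proof (cases "\<epsilon> < 2 * log 2 (real d) + 4")
      case True
      define v where "v = pool_bits d \<epsilon>"
      interpret rec: recycler X v True using X by unfold_locales
      note large = pool_bits_large[OF d \<epsilon>, folded v_def]
      have W: "overhead d \<epsilon> = real v + 2" using True by (simp add: overhead_def v_def)
      have lv: "log 2 (real d) \<le> real v"
      proof -
        have "0 \<le> log 2 (lg_scale d \<epsilon> + 8)" using lg_scale_ge[OF d \<epsilon>] by simp
        then show ?thesis using lg_scale_ge[OF d \<epsilon>] pool_bits_bounds[OF d \<epsilon>]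
          unfolding v_def by linarith
      qed
      show ?thesis
      proof (rule exI[of _ rec.sampler], intro conjI allI impI ballI rec.online, goal_cases)
        case (1 p xs)
        have up: "\<And>i. p i \<in> rat_dists_upto X d" using 1 by blast
        let ?n = "real (length xs)" and ?r = "real d / 2 ^ v * (2 * real v + 7)"
        have "(\<integral>\<^sup>+B. entropy_cost rec.sampler X p (length xs) B
              \<partial>uniform_measure coins (output_event rec.sampler X p xs))
            < ennreal ((\<Sum>i<length xs. log 2 (1 / of_rat (p i (xs ! i)))) + (\<epsilon> * ?n + overhead d \<epsilon>))"
        proof (rule expected_cost_less[OF X rec.online, where c = "?n * ?r + (real v + 1)"])
          fix K assume pos: "\<And>i. i < length xs \<Longrightarrow> 0 < p i (xs ! i)"
          have "(1 :: nat) < 2 ^ Suc v" by (rule one_less_power) simp_all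
          then have "rec.avg0 (capped K) p xs 1 \<le> (\<Prod>i<length xs. of_rat (p i (xs ! i))) *
              ((\<Sum>i<length xs. log 2 (1 / of_rat (p i (xs ! i)))) + ?n * ?r + (real v + 1) - log 2 (real 1))"
            using 1(2) pos by (intro rec.avg0_cost[OF TrueI large(1) up]) auto
          then show "value0 rec.sampler X (capped K) p xs (init_state rec.sampler) \<le>
              (\<Prod>i<length xs. of_rat (p i (xs ! i))) *
              ((\<Sum>i<length xs. log 2 (1 / of_rat (p i (xs ! i)))) + (?n * ?r + (real v + 1)))"
            unfolding rec.avg0_1 by (simp add: add.assoc)
        next
          show "?n * ?r + (real v + 1) < \<epsilon> * ?n + overhead d \<epsilon>"
            using mult_right_mono[OF large(2), of ?n] by (simp add: W mult.commute)
          show "0 < \<epsilon> * ?n + overhead d \<epsilon>" using \<epsilon> by (intro add_nonneg_pos) (auto simp: W)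
        qed (use 1 dists in auto)
        then show ?case by (simp only: add.assoc)
      next
        case (2 p)
        then show ?case by (intro rec.carried_space[OF large(1)]) (auto simp: W)
      next
        case (3 p)
        have "a * overhead d \<epsilon> \<le> C * overhead d \<epsilon>"
        proof (rule mult_right_mono)
          have "a * 1 \<le> a * (9 + 2 * log 2 D)" using a lD by (intro mult_left_mono) auto
          then show "a \<le> C" using Ca by linarith
        qed (simp add: W)
        moreover have "4 * real v + 8 + 2 * (real (Suc (card X)) * (log 2 (real d) + 1)) \<le> a * overhead d \<epsilon>"
          using lv by (intro temp_le) (auto simp: W)
        ultimately show ?case
          using 3 by (intro rec.temp_space[OF large(1)]) auto
      qed
    next
      case False
      have W: "overhead d \<epsilon> = max 1 (log 2 (real d / \<epsilon>))" using False by (simp add: overhead_def)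
      then have W1: "1 \<le> overhead d \<epsilon>" by simp
      show ?thesis
      proof (cases "2 ^ (card X + 2) * (8 + 5 * (log 2 (real d) + 1) + ?l) \<le> \<epsilon>")
        case True
        show ?thesis
        proof (rule exI[of _ small.sampler], intro conjI allI impI ballI small.online, goal_cases)
          case (1 p xs)
          have up: "\<And>i. p i \<in> rat_dists_upto X d" using 1 by blast
          let ?n = "real (length xs)"
          let ?b = "2 ^ (card X + 2) * (8 + 5 * (log 2 (real d) + 1) + ?l)"
          have "(\<integral>\<^sup>+B. entropy_cost small.sampler X p (length xs) B
                \<partial>uniform_measure coins (output_event small.sampler X p xs))
              < ennreal ((\<Sum>i<length xs. log 2 (1 / of_rat (p i (xs ! i)))) + (\<epsilon> * ?n + overhead d \<epsilon>))"
          proof (rule expected_cost_less[OF X small.online, where c = "?b * ?n"])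
            fix K assume nn: "0 \<le> (\<Sum>i<length xs. log 2 (1 / of_rat (p i (xs ! i)) :: real))"
              "0 \<le> (\<Prod>i<length xs. of_rat (p i (xs ! i)) :: real)"
            have "value0 small.sampler X (capped K) p xs [] \<le> (\<Prod>i<length xs. of_rat (p i (xs ! i))) * (?b * ?n)"
              using 1(2) dists up length_input_tape_le[OF X up] by (intro small.value0_cost) auto
            also have "\<dots> \<le> (\<Prod>i<length xs. of_rat (p i (xs ! i))) *
                ((\<Sum>i<length xs. log 2 (1 / of_rat (p i (xs ! i)))) + ?b * ?n)"
              using nn by (intro mult_left_mono) auto
            finally show "value0 small.sampler X (capped K) p xs (init_state small.sampler) \<le>
                (\<Prod>i<length xs. of_rat (p i (xs ! i))) *
                ((\<Sum>i<length xs. log 2 (1 / of_rat (p i (xs ! i)))) + ?b * ?n)" by simp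
          next
            show "?b * ?n < \<epsilon> * ?n + overhead d \<epsilon>"
              using mult_right_mono[OF True, of ?n] W1 by simp
            show "0 < \<epsilon> * ?n + overhead d \<epsilon>" using \<epsilon> W1 by (intro add_nonneg_pos) auto
          qed (use 1 dists in auto)
          then show ?case by (simp only: add.assoc)
        next
          case (2 p)
          then show ?case using W1 by (intro small.carried_space) auto
        next
          case (3 p)
          have "real (card small.phases) * 1 \<le> C * overhead d \<epsilon>"
            using Ca(2) C0 W1 by (intro mult_mono) auto
          then show ?case by (intro small.temp_space) auto
        qed
      next
        case small_eps: False
        define v where "v = Suc (nat \<lceil>log 2 (real d)\<rceil>)"
        interpret rec: recycler X v False using X by unfold_locales
        have v: "real v \<le> log 2 (real d) + 2" unfolding v_def using log_d by linarith
        have dv: "2 * d \<le> 2 ^ v"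
        proof -
          have "real d = 2 powr log 2 (real d)" using d by simp
          also have "\<dots> \<le> 2 powr real (nat \<lceil>log 2 (real d)\<rceil>)"
            by (intro powr_mono real_nat_ceiling_ge) auto
          finally have "real d \<le> real (2 ^ nat \<lceil>log 2 (real d)\<rceil>)" by (simp add: powr_realpow)
          then have "d \<le> 2 ^ nat \<lceil>log 2 (real d)\<rceil>" by (simp only: of_nat_le_iff)
          then show ?thesis by (simp add: v_def)
        qed
        have lW: "log 2 (real d) + 4 \<le> (9 + 2 * log 2 D) * overhead d \<epsilon>"
        proof -
          let ?s = "log 2 (real d)"
          have "\<epsilon> \<le> 2 ^ (card X + 2) * ((13 + ?l) * (?s + 1))"
          proof (rule order.trans)
            show "\<epsilon> \<le> 2 ^ (card X + 2) * (8 + 5 * (?s + 1) + ?l)" using small_eps by simp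
            show "2 ^ (card X + 2) * (8 + 5 * (?s + 1) + ?l) \<le> 2 ^ (card X + 2) * ((13 + ?l) * (?s + 1))"
              using log_d by (intro mult_left_mono) (auto simp: algebra_simps)
          qed
          then have "\<epsilon> \<le> D * (?s + 1)" by (simp add: D_def)
          then have "log 2 \<epsilon> \<le> log 2 (D * (?s + 1))" using \<epsilon> by (intro log_mono) auto
          also have "\<dots> = log 2 D + log 2 (?s + 1)" using D log_d by (simp add: log_mult)
          also have "log 2 (?s + 1) \<le> 1 + (?s + 1) / 2" using log_d by (intro log2_le_half) simp
          finally have le: "log 2 \<epsilon> \<le> log 2 D + ?s / 2 + 3 / 2"
            by (simp add: add_divide_distrib)
          have "?s - log 2 \<epsilon> = log 2 (real d / \<epsilon>)" using d \<epsilon> by (simp add: log_divide)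
          also have "\<dots> \<le> overhead d \<epsilon>" by (simp add: W)
          finally have "?s \<le> 2 * overhead d \<epsilon> + 2 * log 2 D + 3" using le by simp
          moreover have "2 * log 2 D + 7 \<le> (2 * log 2 D + 7) * overhead d \<epsilon>"
            using mult_left_mono[OF W1, of "2 * log 2 D + 7"] lD by simp
          ultimately show ?thesis by (simp add: algebra_simps)
        qed
        show ?thesis
        proof (rule exI[of _ rec.sampler], intro conjI allI impI ballI rec.online, goal_cases)
          case (1 p xs)
          have up: "\<And>i. p i \<in> rat_dists_upto X d" using 1 by blast
          let ?n = "real (length xs)"
          have "(\<integral>\<^sup>+B. entropy_cost rec.sampler X p (length xs) B
                \<partial>uniform_measure coins (output_event rec.sampler X p xs))
              < ennreal ((\<Sum>i<length xs. log 2 (1 / of_rat (p i (xs ! i)))) + (\<epsilon> * ?n + overhead d \<epsilon>))"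
          proof (rule expected_cost_less[OF X rec.online, where c = "2 * real v * ?n"])
            fix K assume nn: "0 \<le> (\<Sum>i<length xs. log 2 (1 / of_rat (p i (xs ! i)) :: real))"
              "0 \<le> (\<Prod>i<length xs. of_rat (p i (xs ! i)) :: real)"
            have "value0 rec.sampler X (capped K) p xs (enc X (0, 1, [])) \<le>
                (\<Prod>i<length xs. of_rat (p i (xs ! i))) * (2 * real v * ?n)"
              using 1(2) by (intro rec.value0_cost_forget[OF _ dv up]) auto
            also have "\<dots> \<le> (\<Prod>i<length xs. of_rat (p i (xs ! i))) *
                ((\<Sum>i<length xs. log 2 (1 / of_rat (p i (xs ! i)))) + 2 * real v * ?n)"
              using nn by (intro mult_left_mono) auto
            finally show "value0 rec.sampler X (capped K) p xs (init_state rec.sampler) \<le>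
                (\<Prod>i<length xs. of_rat (p i (xs ! i))) *
                ((\<Sum>i<length xs. log 2 (1 / of_rat (p i (xs ! i)))) + 2 * real v * ?n)" by simp
          next
            show "2 * real v * ?n < \<epsilon> * ?n + overhead d \<epsilon>"
              using mult_right_mono[of "2 * real v" \<epsilon> ?n] v False W1 by simp
            show "0 < \<epsilon> * ?n + overhead d \<epsilon>" using \<epsilon> W1 by (intro add_nonneg_pos) auto
          qed (use 1 dists in auto)
          then show ?case by (simp only: add.assoc)
        next
          case (2 p)
          then show ?case using W1 by (intro rec.carried_space[OF dv]) auto
        next
          case (3 p)
          have "4 * real v + 8 + 2 * (real (Suc (card X)) * (log 2 (real d) + 1)) \<le> a * (log 2 (real d) + 4)"
            using v by (intro temp_le) auto
          also have "\<dots> \<le> a * ((9 + 2 * log 2 D) * overhead d \<epsilon>)" using lW a by (rule mult_left_mono)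
          also have "\<dots> \<le> C * overhead d \<epsilon>"
            unfolding mult.assoc[symmetric] using Ca(1) W1 by (intro mult_right_mono) auto
          finally show ?case using 3 by (intro rec.temp_space[OF dv]) auto
        qed
      qed
    qed
  qed
qed

theorem theorem1p1:
  "\<exists>W :: nat \<Rightarrow> real \<Rightarrow> real.
     (\<lambda>(d, \<epsilon>). W d \<epsilon>)
       \<sim>[filtercomap (\<lambda>(d, \<epsilon>). real d / \<epsilon>) at_top] (\<lambda>(d, \<epsilon>). log 2 (real d / \<epsilon>)) \<and>
     (\<forall>X :: 'a set. finite X \<and> X \<noteq> {} \<longrightarrow>
       (\<exists>C :: real. \<forall>d \<ge> 1. \<forall>\<epsilon> > 0. \<exists>S :: 'a sampler.
          online_sampler X S \<and>
          (\<forall>p. (\<forall>i. p i \<in> rat_dists_upto X d) \<longrightarrow>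
             (\<forall>xs \<in> lists X. length xs \<ge> 1 \<and> measure coins (output_event S X p xs) > 0 \<longrightarrow>
                (\<integral>\<^sup>+B. entropy_cost S X p (length xs) B
                    \<partial>uniform_measure coins (output_event S X p xs))
                  < ennreal ((\<Sum>i<length xs. log 2 (1 / of_rat (p i (xs ! i))))
                              + \<epsilon> * real (length xs) + W d \<epsilon>)) \<and>
             carried_space_le S X p (2 * W d \<epsilon>) \<and>
             temp_space_le S X p (C * W d \<epsilon>))))"
  using overhead_asymp sampler_exists by blast

end
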